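(* The decision problem "given a finite state synchronous machine $M$, does $M$ satisfy restrictiveness ($M\in\mathrm{RES}$)?" is in PTIME (decidable in polynomial time).
   Context: A synchronous machine is a tuple $M=\langle S,A,s_0,\rightarrow,O,\mathrm{obs}\rangle$ where $S$ is a set of states, $A=A_H\times A_L$ is a set of joint actions ($A_H$ the actions of agent $H$, $A_L$ the actions of agent $L$), $s_0\in S$ is the initial state, $\rightarrow\subseteq S\times A\times S$ is the transition relation (write $s\xrightarrow{a}s'$), $O$ is a set of observations, and $\mathrm{obs}:S\times\{H,L\}\to O$; write $\mathrm{obs}_u=\mathrm{obs}(\cdot,u)$. Machines are input-enabled: for all $s\in S$, $a\in A$ there is $s'$ with $s\xrightarrow{a}s'$. The machine is finite state if $S,A_H,A_L,O$ are finite; as an input to a decision problem it is given by explicit listing of all its components. A synchronous unwinding relation on $M$ is a symmetric relation $\sim\subseteq S\times S$ such that: (1) $s_0\sim s_0$; (2) $s\sim t$ implies $\mathrm{obs}_L(s)=\mathrm{obs}_L(t)$; (3) $s\sim t$ implies that for all $a_1,a_2\in A_H$ and $a_3\in A_L$, if $s\xrightarrow{(a_1,a_3)}s'$ then there exists a state $t'$ with $t\xrightarrow{(a_2,a_3)}t'$ and $s'\sim t'$. $M\in\mathrm{RES}$ iff there exists a synchronous unwinding relation on $M$. *)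

theory Defs
  imports "HOL-Computational_Algebra.Polynomial"
begin

datatype agent = AgH | AgL

record ('s, 'h, 'l, 'o) machine =
  states :: "'s set"
  acts_H :: "'h set"
  acts_L :: "'l set"
  initial :: 's
  trans_rel :: "('s \<times> ('h \<times> 'l) \<times> 's) set"
  observations :: "'o set"
  obs :: "'s \<Rightarrow> agent \<Rightarrow> 'o"

definition synchronous_machine :: "('s, 'h, 'l, 'o) machine \<Rightarrow> bool" where
  "synchronous_machine M \<longleftrightarrow>
     initial M \<in> states M \<and>
     trans_rel M \<subseteq> states M \<times> (acts_H M \<times> acts_L M) \<times> states M \<and>
     (\<forall>s\<in>states M. \<forall>u. obs M s u \<in> observations M) \<and>
     (\<forall>s\<in>states M. \<forall>a\<in>acts_H M \<times> acts_L M. \<exists>s'\<in>states M. (s, a, s') \<in> trans_rel M)"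

definition finite_state :: "('s, 'h, 'l, 'o) machine \<Rightarrow> bool" where
  "finite_state M \<longleftrightarrow>
     finite (states M) \<and> finite (acts_H M) \<and> finite (acts_L M) \<and> finite (observations M)"

definition synchronous_unwinding ::
    "('s, 'h, 'l, 'o) machine \<Rightarrow> ('s \<times> 's) set \<Rightarrow> bool" where
  "synchronous_unwinding M R \<longleftrightarrow>
     R \<subseteq> states M \<times> states M \<and> sym R \<and>
     (initial M, initial M) \<in> R \<and>
     (\<forall>s t. (s, t) \<in> R \<longrightarrow> obs M s AgL = obs M t AgL) \<and>
     (\<forall>s t. (s, t) \<in> R \<longrightarrow>
        (\<forall>a1\<in>acts_H M. \<forall>a2\<in>acts_H M. \<forall>a3\<in>acts_L M. \<forall>s'.
           (s, (a1, a3), s') \<in> trans_rel M \<longrightarrow>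
           (\<exists>t'. (t, (a2, a3), t') \<in> trans_rel M \<and> (s', t') \<in> R)))"

definition RES :: "('s, 'h, 'l, 'o) machine set" where
  "RES = {M. \<exists>R. synchronous_unwinding M R}"

datatype 'a cell = Blank | Inp 'a | Work nat

datatype move = MoveLeft | Stay | MoveRight

text \<open>Control states and auxiliary tape symbols are drawn from the natural numbers, which
  loses no generality since both sets are required to be finite.\<close>

record 'a tm =
  tm_tapes :: nat
  tm_states :: "nat set"
  tm_alphabet :: "'a cell set"
  tm_start :: nat
  tm_accept :: nat
  tm_reject :: nat
  tm_delta :: "nat \<Rightarrow> 'a cell list \<Rightarrow> nat \<times> ('a cell \<times> move) list"

definition wf_tm :: "'a tm \<Rightarrow> bool" where
  "wf_tm T \<longleftrightarrow>
     tm_tapes T \<ge> 1 \<and> finite (tm_states T) \<and> finite (tm_alphabet T) \<and>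
     Blank \<in> tm_alphabet T \<and> range Inp \<subseteq> tm_alphabet T \<and>
     {tm_start T, tm_accept T, tm_reject T} \<subseteq> tm_states T \<and> tm_accept T \<noteq> tm_reject T \<and>
     (\<forall>q\<in>tm_states T. \<forall>cs. length cs = tm_tapes T \<and> set cs \<subseteq> tm_alphabet T \<longrightarrow>
        (case tm_delta T q cs of (q', acts) \<Rightarrow>
           q' \<in> tm_states T \<and> length acts = tm_tapes T \<and> fst ` set acts \<subseteq> tm_alphabet T))"

text \<open>A tape is a two-way infinite cell array together with the position of its head.\<close>

type_synonym 'a tape = "(int \<Rightarrow> 'a cell) \<times> int"

fun read_tape :: "'a tape \<Rightarrow> 'a cell" where
  "read_tape (f, p) = f p"

fun move_offset :: "move \<Rightarrow> int" where
  "move_offset MoveLeft = -1"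
| "move_offset Stay = 0"
| "move_offset MoveRight = 1"

fun act_tape :: "'a cell \<times> move \<Rightarrow> 'a tape \<Rightarrow> 'a tape" where
  "act_tape (c, m) (f, p) = (f(p := c), p + move_offset m)"

type_synonym 'a config = "nat \<times> 'a tape list"

fun tm_step :: "'a tm \<Rightarrow> 'a config \<Rightarrow> 'a config" where
  "tm_step T (q, ts) =
     (if q \<in> {tm_accept T, tm_reject T} then (q, ts)
      else case tm_delta T q (map read_tape ts) of (q', acts) \<Rightarrow> (q', map2 act_tape acts ts))"

definition blank_tape :: "'a tape" where
  "blank_tape = (\<lambda>_. Blank, 0)"

definition input_tape :: "'a list \<Rightarrow> 'a tape" where
  "input_tape w =
     (\<lambda>i. if 0 \<le> i \<and> i < int (length w) then Inp (w ! nat i) else Blank, 0)"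

definition tm_initial :: "'a tm \<Rightarrow> 'a list \<Rightarrow> 'a config" where
  "tm_initial T w = (tm_start T, input_tape w # replicate (tm_tapes T - 1) blank_tape)"

definition decides_in_time :: "'a tm \<Rightarrow> 'a list set \<Rightarrow> (nat \<Rightarrow> nat) \<Rightarrow> bool" where
  "decides_in_time T X time \<longleftrightarrow>
     (\<forall>w. \<exists>n \<le> time (length w).
        fst ((tm_step T ^^ n) (tm_initial T w)) = (if w \<in> X then tm_accept T else tm_reject T))"

definition PTIME :: "'a list set set" where
  "PTIME = {X. \<exists>T. \<exists>p :: nat poly. wf_tm T \<and> decides_in_time T X (poly p)}"

text \<open>In an input, states, actions and observations are named by arbitrary bit strings. Each
  component is written as a sequence of names, every name being terminated by a comma and the
  whole component by a semicolon. The transition relation is a table of rows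
  \<open>s, a\<^sub>H, a\<^sub>L, s'\<close>, the observation function a table of rows \<open>s, obs\<^sub>H(s), obs\<^sub>L(s)\<close>. Entries may
  come in any order and may be repeated.\<close>

datatype symbol = Bit bool | Comma | Semicolon

type_synonym name = "bool list"

type_synonym named_machine = "(name, name, name, name) machine"

definition encode_name :: "name \<Rightarrow> symbol list" where
  "encode_name x = map Bit x @ [Comma]"

definition encode_component :: "name list \<Rightarrow> symbol list" where
  "encode_component xs = concat (map encode_name xs) @ [Semicolon]"

definition encodes :: "symbol list \<Rightarrow> named_machine \<Rightarrow> bool" where
  "encodes w M \<longleftrightarrow> (\<exists>ss hs ls ts os bs.
     set ss = states M \<and> set hs = acts_H M \<and> set ls = acts_L M \<and>
     set ts = trans_rel M \<and> set os = observations M \<and>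
     set bs = (\<lambda>s. (s, obs M s AgH, obs M s AgL)) ` states M \<and>
     w = encode_component ss @ encode_component hs @ encode_component ls @
         encode_component [initial M] @
         encode_component (concat (map (\<lambda>(s, (a, b), s'). [s, a, b, s']) ts)) @
         encode_component os @
         encode_component (concat (map (\<lambda>(s, x, y). [s, x, y]) bs)))"

definition RES_problem :: "symbol list set" where
  "RES_problem =
     {w. \<exists>M. synchronous_machine M \<and> finite_state M \<and> encodes w M \<and> M \<in> RES}"

end

(* Restrictiveness is a greatest fixed point: starting from all pairs of states, delete the
   pairs that violate the unwinding conditions with respect to the surviving pairs, where the
   swapped pair is also required to survive so that the limit is symmetric. Every unwinding
   relation survives each round, and after |S|^2 rounds nothing more can be deleted, so M is in
   RES iff (s_0, s_0) survives.

   Polynomial time on Turing machines: structured programs on stacks are compiled to machines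
   with one tape per stack. A function is in polynomial time in a context of stacks if some
   program pushes its value within a polynomial bound and leaves all other stacks unchanged.
   Such functions are closed under composition, case distinction on the topmost symbol, and
   folds over the iterates of a function that shortens lists, provided that the accumulator
   stays polynomially bounded. Quantification over the names or rows in a text is such a fold,
   so well-formedness of the input and each deletion round are in polynomial time by their
   logical form. *)

theory Submission imports Defs
begin

section \<open>Programs on stacks\<close>

text \<open>Stacks are the data type because a tape whose head rests on the top symbol performs
  every stack operation in one or two machine steps, without any search along the tape. Since only
  tops are visible, a list is traversed through its suffixes: a suffix is again the content of a
  stack, and the name or row at its front is a function of it. Numbers are not represented. Where a
  loop needs a counter, a list of suitable length is consumed; the |S|^2 rounds are counted by the
  rows of the text of all pairs. Polynomial time is not closed under iteration, since a step that
  doubles a list leads to exponential length. Folds therefore come with a separate size bound,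
  imposed only on accumulators that are reached. Two forms of names have to be reconciled: programs
  compare words over the input alphabet, whereas machines are named by bit strings. The relational
  core is polymorphic in the names and built from equality and membership, hence invariant under
  injective renaming.\<close>

datatype 'a cmd =
    Skip
  | Push nat 'a
  | Put nat 'a
  | Dup nat nat
  | PutTop nat nat
  | Pop nat
  | Seq "'a cmd" "'a cmd"
  | Cond nat "'a option \<Rightarrow> bool" "'a cmd" "'a cmd"
  | Loop nat "'a option \<Rightarrow> bool" "'a cmd"
  | Halt bool

type_synonym 'a store = "nat \<Rightarrow> 'a list"

fun peek :: "'a list \<Rightarrow> 'a option" where
  "peek [] = None"
| "peek (x # xs) = Some x"

text \<open>\<^const>\<open>Put\<close> and \<^const>\<open>PutTop\<close> are the second halves of \<^const>\<open>Push\<close> and \<^const>\<open>Dup\<close>: a Turing machine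
  needs one step to move the head and one to write. They and \<^const>\<open>Halt\<close> have no rule
  because they do not act on stacks.\<close>

inductive exec :: "'a cmd \<Rightarrow> 'a store \<Rightarrow> nat \<Rightarrow> 'a store \<Rightarrow> bool" where
  exec_Skip: "exec Skip \<sigma> 1 \<sigma>"
| exec_Push: "exec (Push v x) \<sigma> 2 (\<sigma>(v := x # \<sigma> v))"
| exec_Dup: "\<sigma> u = x # xs \<Longrightarrow> u \<noteq> v \<Longrightarrow> exec (Dup u v) \<sigma> 2 (\<sigma>(v := x # \<sigma> v))"
| exec_Pop: "exec (Pop v) \<sigma> 1 (\<sigma>(v := tl (\<sigma> v)))"
| exec_Seq: "exec a \<sigma> t \<sigma>' \<Longrightarrow> exec b \<sigma>' t' \<sigma>'' \<Longrightarrow> exec (Seq a b) \<sigma> (Suc (t + t')) \<sigma>''"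
| exec_CondT: "P (peek (\<sigma> v)) \<Longrightarrow> exec a \<sigma> t \<sigma>' \<Longrightarrow> exec (Cond v P a b) \<sigma> (Suc t) \<sigma>'"
| exec_CondF: "\<not> P (peek (\<sigma> v)) \<Longrightarrow> exec b \<sigma> t \<sigma>' \<Longrightarrow> exec (Cond v P a b) \<sigma> (Suc t) \<sigma>'"
| exec_LoopF: "\<not> P (peek (\<sigma> v)) \<Longrightarrow> exec (Loop v P a) \<sigma> 1 \<sigma>"
| exec_LoopT: "P (peek (\<sigma> v)) \<Longrightarrow> exec a \<sigma> t \<sigma>' \<Longrightarrow> exec (Loop v P a) \<sigma>' t' \<sigma>'' \<Longrightarrow>
    exec (Loop v P a) \<sigma> (Suc (t + t')) \<sigma>''"

text \<open>A unit of time puts at most one symbol on a stack. Hence every time bound is also a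
  bound on the size of results, which is what composition requires.\<close>

lemma length_exec_le: "exec c \<sigma> t \<sigma>' \<Longrightarrow> length (\<sigma>' v) \<le> length (\<sigma> v) + t"
  by (induction rule: exec.induct) auto

text \<open>The number of tapes on which a program can run: one more than its largest stack
  index.\<close>

fun width :: "'a cmd \<Rightarrow> nat" where
  "width (Push v x) = Suc v"
| "width (Put v x) = Suc v"
| "width (Dup u v) = Suc (max u v)"
| "width (PutTop u v) = Suc (max u v)"
| "width (Pop v) = Suc v"
| "width (Seq a b) = max (width a) (width b)"
| "width (Cond v P a b) = Max {Suc v, width a, width b}"
| "width (Loop v P a) = max (Suc v) (width a)"
| "width _ = 0"

section \<open>Compilation to Turing machines\<close>

text \<open>The control state is the list of commands that remain to be executed.\<close>

definition idle :: "'a cell list \<Rightarrow> ('a cell \<times> move) list" where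
  "idle cs = map (\<lambda>c. (c, Stay)) cs"

text \<open>Reading outside the tapes yields a blank, just as an update outside a list changes
  nothing. So \<open>next_control\<close> returns actions of the right form for every command list,
  whatever indices occur in it.\<close>

definition cell_at :: "'a cell list \<Rightarrow> nat \<Rightarrow> 'a cell" where
  "cell_at cs v = (if v < length cs then cs ! v else Blank)"

fun cell_symbol :: "'a cell \<Rightarrow> 'a option" where
  "cell_symbol (Inp x) = Some x"
| "cell_symbol _ = None"

fun next_control :: "'a cmd list \<Rightarrow> 'a cell list \<Rightarrow> 'a cmd list \<times> ('a cell \<times> move) list" where
  "next_control (Skip # k) cs = (k, idle cs)"
| "next_control (Push v x # k) cs = (Put v x # k, (idle cs)[v := (cell_at cs v, MoveLeft)])"
| "next_control (Put v x # k) cs = (k, (idle cs)[v := (Inp x, Stay)])"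
| "next_control (Dup u v # k) cs = (PutTop u v # k, (idle cs)[v := (cell_at cs v, MoveLeft)])"
| "next_control (PutTop u v # k) cs = (k, (idle cs)[v := (cell_at cs u, Stay)])"
| "next_control (Pop v # k) cs = (k, (idle cs)[v := (cell_at cs v, MoveRight)])"
| "next_control (Seq a b # k) cs = (a # b # k, idle cs)"
| "next_control (Cond v P a b # k) cs =
    ((if P (cell_symbol (cell_at cs v)) then a else b) # k, idle cs)"
| "next_control (Loop v P a # k) cs =
    (if P (cell_symbol (cell_at cs v)) then a # Loop v P a # k else k, idle cs)"
| "next_control k cs = (k, idle cs)"

fun control_step :: "'a cmd list \<times> 'a tape list \<Rightarrow> 'a cmd list \<times> 'a tape list" where
  "control_step (k, ts) =
    (case next_control k (map read_tape ts) of (k', acts) \<Rightarrow> (k', map2 act_tape acts ts))"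

text \<open>The stack on a tape extends to the right of the head, which stands on its top element;
  the cells to the left of the head are arbitrary.\<close>

definition holds_list :: "'a tape \<Rightarrow> 'a list \<Rightarrow> bool" where
  "holds_list tp xs \<longleftrightarrow>
    (\<forall>j. fst tp (snd tp + int j) = (if j < length xs then Inp (xs ! j) else Blank))"

definition holds :: "nat \<Rightarrow> 'a tape list \<Rightarrow> 'a store \<Rightarrow> bool" where
  "holds K ts \<sigma> \<longleftrightarrow> length ts = K \<and> (\<forall>v<K. holds_list (ts ! v) (\<sigma> v))"

lemma act_tape_read: "act_tape (read_tape tp, d) tp = (fst tp, snd tp + move_offset d)"
  by (cases tp) auto

lemma read_tape_holds: "holds_list tp xs \<Longrightarrow>
    read_tape tp = (case xs of [] \<Rightarrow> Blank | x # _ \<Rightarrow> Inp x)"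
  unfolding holds_list_def
  by (cases tp; drule spec[where x=0]) (auto split: list.split)

lemma cell_symbol_holds: "holds_list tp xs \<Longrightarrow> cell_symbol (read_tape tp) = peek xs"
  by (auto simp: read_tape_holds split: list.split)

text \<open>The popped symbol stays on the tape, to the left of the head, where the invariant asks
  nothing. On an empty stack the move is harmless, as only blanks lie ahead.\<close>

lemma holds_list_tl:
  assumes "holds_list tp xs" shows "holds_list (fst tp, snd tp + 1) (tl xs)"
  unfolding holds_list_def
proof
  fix j
  have "fst tp (snd tp + int (Suc j)) = (if Suc j < length xs then Inp (xs ! Suc j) else Blank)"
    using assms unfolding holds_list_def by blast
  then show "fst (fst tp, snd tp + 1) (snd (fst tp, snd tp + 1) + int j) =
      (if j < length (tl xs) then Inp (tl xs ! j) else Blank)"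
    by (auto simp: nth_tl add.assoc)
qed

lemma holds_list_Cons:
  assumes "holds_list tp xs"
  shows "holds_list (act_tape (Inp x, Stay) (fst tp, snd tp - 1)) (x # xs)"
  unfolding holds_list_def
proof
  fix j
  show "fst (act_tape (Inp x, Stay) (fst tp, snd tp - 1))
      (snd (act_tape (Inp x, Stay) (fst tp, snd tp - 1)) + int j) =
      (if j < length (x # xs) then Inp ((x # xs) ! j) else Blank)"
    using assms by (cases j) (auto simp: holds_list_def)
qed

lemma map2_act_idle: "map2 act_tape (idle (map read_tape ts)) ts = ts"
  by (rule nth_equalityI) (auto simp: idle_def act_tape_read)

lemma map2_act_update:
  assumes "v < length ts"
  shows "map2 act_tape ((idle (map read_tape ts))[v := a]) ts = ts[v := act_tape a (ts ! v)]"
  using assms by (intro nth_equalityI) (auto simp: idle_def nth_list_update act_tape_read)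

lemma holds_update:
  "holds K ts \<sigma> \<Longrightarrow> holds_list tp xs \<Longrightarrow> holds K (ts[v := tp]) (\<sigma>(v := xs))"
  by (auto simp: holds_def nth_list_update)

lemma cell_at_read: "v < length ts \<Longrightarrow> cell_at (map read_tape ts) v = read_tape (ts ! v)"
  by (simp add: cell_at_def)

text \<open>Times in \<open>exec\<close> are exact step counts of the control. The continuation
  \<open>k\<close> is arbitrary because the parts of a sequence or a loop run in front of further
  commands: the induction hypotheses are used with \<open>b # k\<close> and with the loop itself in
  front of \<open>k\<close>.\<close>

lemma exec_control_step:
  assumes "exec c \<sigma> t \<sigma>'" "holds K ts \<sigma>" "width c \<le> K"
  shows "\<exists>ts'. (control_step ^^ t) (c # k, ts) = (k, ts') \<and> holds K ts' \<sigma>'"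
  using assms
proof (induction arbitrary: ts k rule: exec.induct)
  case (exec_Skip \<sigma>)
  then show ?case by (simp add: map2_act_idle)
next
  case (exec_Push v x \<sigma>)
  then have v: "v < length ts" and h: "holds_list (ts ! v) (\<sigma> v)"
    by (auto simp: holds_def)
  let ?tp = "(fst (ts ! v), snd (ts ! v) - 1)"
  have "(control_step ^^ 2) (Push v x # k, ts) = (k, ts[v := act_tape (Inp x, Stay) ?tp])"
    using v by (simp add: numeral_2_eq_2 map2_act_update cell_at_read act_tape_read del: act_tape.simps)
  then show ?case
    using holds_update[OF exec_Push(1) holds_list_Cons[OF h]] by blast
next
  case (exec_Dup \<sigma> u x xs v)
  from exec_Dup.prems have v: "v < length ts" and u: "u < length ts"
    and h: "holds_list (ts ! v) (\<sigma> v)" and hu: "holds_list (ts ! u) (\<sigma> u)"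
    by (auto simp: holds_def)
  let ?tp = "(fst (ts ! v), snd (ts ! v) - 1)"
  have "(control_step ^^ 2) (Dup u v # k, ts) = (k, ts[v := act_tape (Inp x, Stay) ?tp])"
    using v u \<open>u \<noteq> v\<close> read_tape_holds[OF hu] \<open>\<sigma> u = x # xs\<close>
    by (simp add: numeral_2_eq_2 map2_act_update cell_at_read act_tape_read del: act_tape.simps)
  then show ?case
    using holds_update[OF \<open>holds K ts \<sigma>\<close> holds_list_Cons[OF h]] by blast
next
  case (exec_Pop v \<sigma>)
  then have v: "v < length ts" and h: "holds_list (ts ! v) (\<sigma> v)"
    by (auto simp: holds_def)
  have "(control_step ^^ 1) (Pop v # k, ts) = (k, ts[v := (fst (ts ! v), snd (ts ! v) + 1)])"
    using v by (simp add: map2_act_update cell_at_read act_tape_read del: act_tape.simps)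
  then show ?case
    using holds_update[OF exec_Pop(1) holds_list_tl[OF h]] by blast
next
  case (exec_Seq a \<sigma> t \<sigma>' b t' \<sigma>'')
  obtain ts1 where 1: "(control_step ^^ t) (a # b # k, ts) = (b # k, ts1)" "holds K ts1 \<sigma>'"
    using exec_Seq.IH(1)[of ts "b # k"] exec_Seq.prems by auto
  obtain ts2 where 2: "(control_step ^^ t') (b # k, ts1) = (k, ts2)" "holds K ts2 \<sigma>''"
    using exec_Seq.IH(2)[of ts1 k] exec_Seq.prems 1 by auto
  \<comment> \<open>\<open>funpow_add\<close> performs the second summand first, so the sum is
    commuted before it is split.\<close>
  have "(control_step ^^ Suc (t + t')) (Seq a b # k, ts) = (k, ts2)"
    using 1 2 by (simp add: funpow_Suc_right funpow_add add.commute[of t] map2_act_idle del: funpow.simps)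
  then show ?case using 2 by blast
next
  case (exec_CondT P \<sigma> v a t \<sigma>' b)
  then have v: "v < length ts" and h: "holds_list (ts ! v) (\<sigma> v)"
    by (auto simp: holds_def)
  have "control_step (Cond v P a b # k, ts) = (a # k, ts)"
    using v exec_CondT(1) by (simp add: map2_act_idle cell_at_read cell_symbol_holds[OF h])
  then show ?case
    using exec_CondT.IH[of ts k] exec_CondT.prems by (simp add: funpow_Suc_right del: funpow.simps)
next
  case (exec_CondF P \<sigma> v b t \<sigma>' a)
  then have v: "v < length ts" and h: "holds_list (ts ! v) (\<sigma> v)"
    by (auto simp: holds_def)
  have "control_step (Cond v P a b # k, ts) = (b # k, ts)"
    using v exec_CondF(1) by (simp add: map2_act_idle cell_at_read cell_symbol_holds[OF h])
  then show ?case
    using exec_CondF.IH[of ts k] exec_CondF.prems by (simp add: funpow_Suc_right del: funpow.simps)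
next
  case (exec_LoopF P \<sigma> v a)
  then have v: "v < length ts" and h: "holds_list (ts ! v) (\<sigma> v)"
    by (auto simp: holds_def)
  have "control_step (Loop v P a # k, ts) = (k, ts)"
    using v exec_LoopF(1) by (simp add: map2_act_idle cell_at_read cell_symbol_holds[OF h])
  then show ?case
    using exec_LoopF.prems by simp
next
  case (exec_LoopT P \<sigma> v a t \<sigma>' t' \<sigma>'')
  then have v: "v < length ts" and h: "holds_list (ts ! v) (\<sigma> v)"
    by (auto simp: holds_def)
  have 0: "control_step (Loop v P a # k, ts) = (a # Loop v P a # k, ts)"
    using v exec_LoopT(1) by (simp add: map2_act_idle cell_at_read cell_symbol_holds[OF h])
  obtain ts1 where 1: "(control_step ^^ t) (a # Loop v P a # k, ts) = (Loop v P a # k, ts1)"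
      "holds K ts1 \<sigma>'"
    using exec_LoopT.IH(1)[of ts "Loop v P a # k"] exec_LoopT.prems by auto
  obtain ts2 where 2: "(control_step ^^ t') (Loop v P a # k, ts1) = (k, ts2)" "holds K ts2 \<sigma>''"
    using exec_LoopT.IH(2)[of ts1 k] exec_LoopT.prems 1 by auto
  have "(control_step ^^ Suc (t + t')) (Loop v P a # k, ts) = (k, ts2)"
    using 0 1 2 by (simp add: funpow_Suc_right funpow_add add.commute[of t] del: funpow.simps control_step.simps)
  then show ?case using 2 by blast
qed

section \<open>Finiteness of the compiled control\<close>

fun residuals :: "'a cmd \<Rightarrow> 'a cmd list set" where
  "residuals (Push v x) = {[Push v x], [Put v x]}"
| "residuals (Dup u v) = {[Dup u v], [PutTop u v]}"
| "residuals (Seq a b) = {[Seq a b]} \<union> (\<lambda>l. l @ [b]) ` residuals a \<union> residuals b"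
| "residuals (Cond v P a b) = {[Cond v P a b]} \<union> residuals a \<union> residuals b"
| "residuals (Loop v P a) = {[Loop v P a]} \<union> (\<lambda>l. l @ [Loop v P a]) ` residuals a"
| "residuals c = {[c]}"

text \<open>\<open>residuals c\<close> contains the nonempty command lists that are left at some
  moment while \<open>c\<close> runs. Pending commands do not pile up, because a loop comes back to
  itself only after its body is used up; so the syntax of \<open>c\<close> bounds the control and
  finitely many states suffice.\<close>

lemma finite_residuals: "finite (residuals c)"
  by (induction c) auto

lemma self_residuals: "[c] \<in> residuals c"
  by (cases c) auto

lemma next_control_append: "l \<noteq> [] \<Longrightarrow> fst (next_control (l @ k) cs) = fst (next_control l cs) @ k"
  by (cases l; cases "hd l") auto

lemma nonempty_residuals: "l \<in> residuals c \<Longrightarrow> l \<noteq> []"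
  by (induction c arbitrary: l) auto

text \<open>The empty list joins the set because the last command of \<open>c\<close> leaves nothing
  behind. A list \<open>l' @ [b]\<close> steps inside \<open>l'\<close> until that part is used up;
  then \<open>[b]\<close> is left, which is a residual of \<open>b\<close>.\<close>

lemma next_control_residuals: "l \<in> residuals c \<Longrightarrow> fst (next_control l cs) \<in> insert [] (residuals c)"
proof (induction c arbitrary: l)
  case (Seq a b)
  then consider "l = [Seq a b]" | l' where "l = l' @ [b]" "l' \<in> residuals a" | "l \<in> residuals b"
    by auto
  then show ?case
  proof cases
    case 1
    then show ?thesis using self_residuals[of a] by (auto simp: image_iff intro: bexI[of _ "[a]"])
  next
    case 2
    then show ?thesis
      using Seq.IH(1)[of l'] nonempty_residuals[of l' a] self_residuals[of b] by (auto simp: next_control_append)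
  next
    case 3
    then show ?thesis using Seq.IH(2)[of l] by auto
  qed
next
  case (Loop v P a)
  then consider "l = [Loop v P a]" | l' where "l = l' @ [Loop v P a]" "l' \<in> residuals a"
    by auto
  then show ?case
  proof cases
    case 1
    then show ?thesis using self_residuals[of a] by (auto simp: image_iff intro: bexI[of _ "[a]"])
  next
    case 2
    then show ?thesis
      using Loop.IH[of l'] nonempty_residuals[of l' a] self_residuals[of a] by (auto simp: next_control_append)
  qed
qed (auto simp: self_residuals)

lemma next_control_actions:
  fixes cs :: "'a cell list"
  assumes "set cs \<subseteq> insert Blank (range Inp)"
  shows "length (snd (next_control l cs)) = length cs"
    and "fst ` set (snd (next_control l cs)) \<subseteq> insert Blank (range Inp)"
proof -
  have 0: "length (idle cs) = length cs" "fst ` set (idle cs) \<subseteq> insert Blank (range Inp)"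
    using assms by (auto simp: idle_def)
  have 1: "fst ` set ((idle cs)[v := a]) \<subseteq> insert Blank (range Inp)"
    if "fst a \<in> insert Blank (range Inp)" for v and a :: "'a cell \<times> move"
    using 0 that set_update_subset_insert[of "idle cs" v a] by blast
  have 2: "cell_at cs v \<in> insert Blank (range Inp)" for v
    using assms by (auto simp: cell_at_def dest: nth_mem)
  show "length (snd (next_control l cs)) = length cs"
    by (cases l; cases "hd l") (auto simp: 0)
  show "fst ` set (snd (next_control l cs)) \<subseteq> insert Blank (range Inp)"
  proof (cases l)
    case Nil
    then show ?thesis using 0 by simp
  next
    case (Cons c k)
    then show ?thesis
      by (cases c) (simp_all only: next_control.simps snd_conv,
          (rule 0 1; simp only: fst_conv; (rule 2 insertI2 rangeI)+)+)
  qed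
qed

text \<open>The input is on stack 0, and the answer is whether stack 1 is nonempty. The test
  \<open>d\<close> behind \<open>c\<close> turns the answer into one of two command lists, which
  become the halting states; an injection on the finite set \<open>Q\<close> numbers the control
  states.\<close>

lemma decider_of_cmd:
  fixes c :: "'a::finite cmd"
  shows "\<exists>T. wf_tm T \<and> (\<forall>w t \<sigma>. exec c ((\<lambda>_. [])(0 := w)) t \<sigma> \<longrightarrow>
    fst ((tm_step T ^^ (t + 3)) (tm_initial T w)) =
      (if \<sigma> 1 \<noteq> [] then tm_accept T else tm_reject T))"
proof -
  define d :: "'a cmd" where "d = Cond 1 (\<lambda>h. h \<noteq> None) (Halt True) (Halt False)"
  \<comment> \<open>Stacks 0 and 1 must exist even if \<open>c\<close> mentions neither.\<close>
  define K where "K = max 2 (width c)"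
  define Q where "Q = insert [] (residuals (Seq c d))"
  have haltQ: "[Halt b] \<in> Q" for b
    by (cases b) (auto simp: Q_def d_def)
  have closed: "fst (next_control l cs) \<in> Q" if "l \<in> Q" for l and cs :: "'a cell list"
    using that next_control_residuals[of l "Seq c d" cs] unfolding Q_def by auto
  have finQ: "finite Q"
    by (simp add: Q_def finite_residuals)
  obtain e :: "'a cmd list \<Rightarrow> nat" where e: "inj_on e Q"
    using finite_imp_inj_to_nat_seg[of Q] finQ by blast
  define T where "T = \<lparr>tm_tapes = K, tm_states = e ` Q, tm_alphabet = insert Blank (range Inp),
    tm_start = e [Seq c d], tm_accept = e [Halt True], tm_reject = e [Halt False],
    tm_delta = (\<lambda>q cs. case next_control (the_inv_into Q e q) cs of (l, acts) \<Rightarrow> (e l, acts))\<rparr>"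
  have startQ: "[Seq c d] \<in> Q"
    by (simp add: Q_def)
  have inv: "the_inv_into Q e (e l) = l" if "l \<in> Q" for l
    by (simp add: e that the_inv_into_f_f)
  have "e [Halt True] \<noteq> e [Halt False]"
    using inj_onD[OF e _ haltQ haltQ] by auto
  moreover have "K \<ge> 1"
    by (simp add: K_def)
  moreover have "case tm_delta T q cs of (q', acts) \<Rightarrow>
      q' \<in> tm_states T \<and> length acts = K \<and> fst ` set acts \<subseteq> tm_alphabet T"
    if "q \<in> e ` Q" "length cs = K" "set cs \<subseteq> insert Blank (range Inp)" for q cs
  proof -
    from that(1) obtain l where l: "l \<in> Q" "q = e l" by blast
    have "tm_delta T q cs = (e (fst (next_control l cs)), snd (next_control l cs))"
      by (simp add: T_def l inv split: prod.split)
    then show ?thesis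
      using closed[OF l(1), of cs] next_control_actions[OF that(3), of l] that(2) by (simp add: T_def)
  qed
  ultimately have wf: "wf_tm T"
    using haltQ startQ finQ unfolding wf_tm_def by (simp add: T_def subset_insertI)
  \<comment> \<open>In the accepting and rejecting states \<open>tm_step\<close> rests without
    consulting \<open>tm_delta\<close>. As \<open>next_control\<close> leaves \<open>Halt\<close> in
    place, both sides agree there as well.\<close>
  have step: "tm_step T (e l, ts) = map_prod e id (control_step (l, ts))" if "l \<in> Q" for l ts
  proof (cases "\<exists>b. l = [Halt b]")
    case True
    then obtain b where "l = [Halt b]" by blast
    then show ?thesis by (cases b) (auto simp: T_def map2_act_idle)
  next
    case False
    then have "e l \<noteq> e [Halt b]" for b
      using inj_onD[OF e _ that haltQ] by blast
    then show ?thesis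
      by (auto simp: T_def inv[OF that] split: prod.split)
  qed
  have steps: "(tm_step T ^^ n) (e l, ts) = map_prod e id ((control_step ^^ n) (l, ts)) \<and>
      fst ((control_step ^^ n) (l, ts)) \<in> Q" if "l \<in> Q" for n l ts
  proof (induction n)
    case 0
    then show ?case using that by simp
  next
    case (Suc n)
    obtain l' ts' where l': "(control_step ^^ n) (l, ts) = (l', ts')" by force
    with Suc have "l' \<in> Q" by simp
    then show ?case
      using Suc l' step[of l' ts'] closed[of l' "map read_tape ts'"]
      by (simp add: case_prod_beta)
  qed
  have "fst ((tm_step T ^^ (t + 3)) (tm_initial T w)) =
      (if \<sigma> 1 \<noteq> [] then tm_accept T else tm_reject T)"
    if ex: "exec c ((\<lambda>_. [])(0 := w)) t \<sigma>" for w t \<sigma>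
  proof -
    define ts where "ts = input_tape w # replicate (K - 1) (blank_tape :: 'a tape)"
    have init: "tm_initial T w = (e [Seq c d], ts)"
      by (simp add: tm_initial_def T_def ts_def)
    have holds: "holds K ts ((\<lambda>_. [])(0 := w))"
      by (auto simp: holds_def ts_def K_def holds_list_def input_tape_def blank_tape_def
          nth_Cons' split: nat.split)
    obtain ts' where ts': "(control_step ^^ t) (c # [d], ts) = ([d], ts')" "holds K ts' \<sigma>"
      using exec_control_step[OF ex holds, of "[d]"] by (auto simp: K_def)
    have 1: "1 < length ts'" and hl: "holds_list (ts' ! 1) (\<sigma> 1)"
      using ts' by (auto simp: holds_def K_def)
    have "control_step ([d], ts') = ([Halt (\<sigma> 1 \<noteq> [])], ts')"
      using 1 by (simp add: d_def map2_act_idle cell_at_read cell_symbol_holds[OF hl[unfolded One_nat_def]])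
        (metis peek.simps list.exhaust option.distinct(1))
    moreover have "control_step ([Halt b], ts') = ([Halt b], ts')" for b
      by (simp add: map2_act_idle)
    moreover have "control_step ([Seq c d], ts) = (c # [d], ts)"
      by (simp add: map2_act_idle)
    \<comment> \<open>One step unfolds \<open>Seq\<close>, \<open>t\<close> steps run
      \<open>c\<close>, one step performs the test, and the last one rests on
      \<open>Halt\<close>.\<close>
    moreover have "t + 3 = Suc (Suc (t + 1))"
      by simp
    ultimately have "(control_step ^^ (t + 3)) ([Seq c d], ts) = ([Halt (\<sigma> 1 \<noteq> [])], ts')"
      using ts'(1) by (simp only: funpow.simps funpow_add o_apply One_nat_def id_apply)
    then show ?thesis
      using steps[OF startQ, of "t + 3" ts] init by (simp add: T_def)
  qed
  with wf show ?thesis by blast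
qed

section \<open>Running times\<close>

definition runs :: "'a cmd \<Rightarrow> 'a store \<Rightarrow> 'a store \<Rightarrow> nat \<Rightarrow> bool" where
  "runs c \<sigma> \<sigma>' b \<longleftrightarrow> (\<exists>t\<le>b. exec c \<sigma> t \<sigma>')"

lemma runs_mono: "runs c \<sigma> \<sigma>' b \<Longrightarrow> b \<le> b' \<Longrightarrow> runs c \<sigma> \<sigma>' b'"
  unfolding runs_def using le_trans by blast

lemma runs_Seq: "runs a \<sigma> \<sigma>' m \<Longrightarrow> runs b \<sigma>' \<sigma>'' n \<Longrightarrow> runs (Seq a b) \<sigma> \<sigma>'' (Suc (m + n))"
  unfolding runs_def by (meson exec_Seq add_le_mono Suc_le_mono)

lemma runs_CondT: "P (peek (\<sigma> v)) \<Longrightarrow> runs a \<sigma> \<sigma>' n \<Longrightarrow> runs (Cond v P a b) \<sigma> \<sigma>' (Suc n)"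
  unfolding runs_def by (meson exec_CondT Suc_le_mono)

lemma runs_CondF: "\<not> P (peek (\<sigma> v)) \<Longrightarrow> runs b \<sigma> \<sigma>' n \<Longrightarrow> runs (Cond v P a b) \<sigma> \<sigma>' (Suc n)"
  unfolding runs_def by (meson exec_CondF Suc_le_mono)

lemma runs_LoopF: "\<not> P (peek (\<sigma> v)) \<Longrightarrow> runs (Loop v P a) \<sigma> \<sigma> 1"
  unfolding runs_def by (meson exec_LoopF order_refl)

lemma runs_LoopT: "P (peek (\<sigma> v)) \<Longrightarrow> runs a \<sigma> \<sigma>' m \<Longrightarrow> runs (Loop v P a) \<sigma>' \<sigma>'' n \<Longrightarrow>
    runs (Loop v P a) \<sigma> \<sigma>'' (Suc (m + n))"
  unfolding runs_def by (meson exec_LoopT add_le_mono Suc_le_mono)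

lemma runs_Push: "runs (Push v x) \<sigma> (\<sigma>(v := x # \<sigma> v)) 2"
  unfolding runs_def by (meson exec_Push order_refl)

lemma runs_Dup: "\<sigma> u \<noteq> [] \<Longrightarrow> u \<noteq> v \<Longrightarrow> runs (Dup u v) \<sigma> (\<sigma>(v := hd (\<sigma> u) # \<sigma> v)) 2"
  unfolding runs_def by (metis exec_Dup order_refl list.collapse)

lemma runs_Pop: "runs (Pop v) \<sigma> (\<sigma>(v := tl (\<sigma> v))) 1"
  unfolding runs_def by (meson exec_Pop order_refl)

lemma runs_Skip: "runs Skip \<sigma> \<sigma> 1"
  unfolding runs_def by (meson exec_Skip order_refl)

lemma length_runs_le: "runs c \<sigma> \<sigma>' b \<Longrightarrow> length (\<sigma>' v) \<le> length (\<sigma> v) + b"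
  unfolding runs_def by (meson length_exec_le add_left_mono le_trans)

section \<open>Moving, copying and overwriting stacks\<close>

abbreviation nonempty :: "'a option \<Rightarrow> bool" where
  "nonempty h \<equiv> h \<noteq> None"

lemma peek_eq_None [simp]: "peek xs = None \<longleftrightarrow> xs = []"
  by (cases xs) auto

definition clear :: "nat \<Rightarrow> 'a cmd" where
  "clear v = Loop v nonempty (Pop v)"

lemma runs_clear: "runs (clear v) \<sigma> (\<sigma>(v := [])) (2 * length (\<sigma> v) + 1)"
proof (induction "\<sigma> v" arbitrary: \<sigma>)
  case Nil
  then have "\<sigma>(v := []) = \<sigma>" by auto
  then show ?case
    using runs_LoopF[of nonempty \<sigma> v "Pop v"] Nil by (simp add: clear_def)
next
  case (Cons x xs)
  let ?\<sigma> = "\<sigma>(v := tl (\<sigma> v))"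
  have xs: "xs = ?\<sigma> v"
    by (simp add: Cons(2)[symmetric])
  have "runs (clear v) ?\<sigma> (\<sigma>(v := [])) (2 * length xs + 1)"
    using Cons(1)[of ?\<sigma>] xs by simp
  from runs_LoopT[OF _ runs_Pop this[unfolded clear_def]] Cons(2)[symmetric]
  show ?case by (simp add: clear_def)
qed

definition transfer :: "nat \<Rightarrow> nat \<Rightarrow> 'a cmd" where
  "transfer u v = Loop u nonempty (Seq (Dup u v) (Pop u))"

text \<open>A round costs 5 steps: one for the loop, one for \<open>Seq\<close>, two for
  \<open>Dup\<close> and one for \<open>Pop\<close>. In \<open>distribute\<close> a second
  \<open>Dup\<close> with its \<open>Seq\<close> raises this to 8.\<close>

lemma runs_transfer:
  "u \<noteq> v \<Longrightarrow> runs (transfer u v) \<sigma> (\<sigma>(u := [], v := rev (\<sigma> u) @ \<sigma> v)) (5 * length (\<sigma> u) + 1)"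
proof (induction "\<sigma> u" arbitrary: \<sigma>)
  case Nil
  then have eq: "\<sigma>(u := [], v := rev (\<sigma> u) @ \<sigma> v) = \<sigma>" by (auto simp: fun_eq_iff)
  show ?case
    unfolding eq transfer_def using Nil by (intro runs_mono[OF runs_LoopF]) simp_all
next
  case (Cons x xs)
  note ux = Cons(2)[symmetric]
  let ?\<sigma> = "\<sigma>(u := xs, v := x # \<sigma> v)"
  have xs: "xs = ?\<sigma> u"
    using Cons.prems by simp
  have 1: "runs (Seq (Dup u v) (Pop u)) \<sigma> ?\<sigma> 4"
    using runs_Seq[OF runs_Dup[of \<sigma> u v] runs_Pop[of u]] ux Cons.prems
    by (simp add: fun_upd_twist)
  have 2: "runs (transfer u v) ?\<sigma> (\<sigma>(u := [], v := rev (\<sigma> u) @ \<sigma> v)) (5 * length xs + 1)"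
    using Cons(1)[of ?\<sigma>] xs ux Cons.prems by (simp add: fun_upd_twist)
  from runs_LoopT[OF _ 1 2[unfolded transfer_def]] ux
  show ?case by (simp add: transfer_def)
qed

definition distribute :: "nat \<Rightarrow> nat \<Rightarrow> nat \<Rightarrow> 'a cmd" where
  "distribute u v w = Loop u nonempty (Seq (Dup u v) (Seq (Dup u w) (Pop u)))"

lemma runs_distribute:
  "distinct [u, v, w] \<Longrightarrow> runs (distribute u v w) \<sigma>
    (\<sigma>(u := [], v := rev (\<sigma> u) @ \<sigma> v, w := rev (\<sigma> u) @ \<sigma> w)) (8 * length (\<sigma> u) + 1)"
proof (induction "\<sigma> u" arbitrary: \<sigma>)
  case Nil
  then have eq: "\<sigma>(u := [], v := rev (\<sigma> u) @ \<sigma> v, w := rev (\<sigma> u) @ \<sigma> w) = \<sigma>"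
    by (auto simp: fun_eq_iff)
  show ?case
    unfolding eq distribute_def using Nil by (intro runs_mono[OF runs_LoopF]) simp_all
next
  case (Cons x xs)
  note ux = Cons(2)[symmetric]
  let ?\<sigma> = "\<sigma>(u := xs, v := x # \<sigma> v, w := x # \<sigma> w)"
  have xs: "xs = ?\<sigma> u"
    using Cons.prems by simp
  have 1: "runs (Seq (Dup u v) (Seq (Dup u w) (Pop u))) \<sigma> ?\<sigma> 7"
  proof -
    have a: "runs (Dup u v) \<sigma> (\<sigma>(v := x # \<sigma> v)) 2"
      using runs_Dup[of \<sigma> u v] ux Cons.prems by simp
    have b: "runs (Dup u w) (\<sigma>(v := x # \<sigma> v)) (\<sigma>(v := x # \<sigma> v, w := x # \<sigma> w)) 2"
      using runs_Dup[of "\<sigma>(v := x # \<sigma> v)" u w] ux Cons.prems by simp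
    have c: "runs (Pop u) (\<sigma>(v := x # \<sigma> v, w := x # \<sigma> w)) ?\<sigma> 1"
    proof -
      have "(\<sigma>(v := x # \<sigma> v, w := x # \<sigma> w))(u := xs) = ?\<sigma>"
        using Cons.prems by (auto simp: fun_eq_iff)
      then show ?thesis
        using runs_Pop[of u "\<sigma>(v := x # \<sigma> v, w := x # \<sigma> w)"] ux Cons.prems by simp
    qed
    show ?thesis
      by (rule runs_mono[OF runs_Seq[OF a runs_Seq[OF b c]]]) simp
  qed
  have 2: "runs (distribute u v w) ?\<sigma>
      (\<sigma>(u := [], v := rev (\<sigma> u) @ \<sigma> v, w := rev (\<sigma> u) @ \<sigma> w)) (8 * length xs + 1)"
    using Cons(1)[of ?\<sigma>] xs ux Cons.prems by (simp add: fun_upd_twist)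
  from runs_LoopT[OF _ 1 2[unfolded distribute_def]] ux
  show ?case by (simp add: distribute_def)
qed

text \<open>Only the top of a stack can be read, so copying \<open>u\<close> means dismantling it.
  Moving it to \<open>w\<close> reverses it, and distributing from \<open>w\<close> reverses it
  again, which restores \<open>u\<close> while \<open>v\<close> is filled.\<close>

definition copy :: "nat \<Rightarrow> nat \<Rightarrow> nat \<Rightarrow> 'a cmd" where
  "copy u v w = Seq (transfer u w) (distribute w u v)"

lemma runs_copy:
  assumes "distinct [u, v, w]" "\<sigma> v = []" "\<sigma> w = []"
  shows "runs (copy u v w) \<sigma> (\<sigma>(v := \<sigma> u)) (13 * length (\<sigma> u) + 3)"
proof -
  let ?\<sigma> = "\<sigma>(u := [], w := rev (\<sigma> u))"
  have 1: "runs (transfer u w) \<sigma> ?\<sigma> (5 * length (\<sigma> u) + 1)"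
    using runs_transfer[of u w \<sigma>] assms by simp
  have eq: "?\<sigma>(w := [], u := rev (?\<sigma> w) @ ?\<sigma> u, v := rev (?\<sigma> w) @ ?\<sigma> v) = \<sigma>(v := \<sigma> u)"
    using assms by (auto simp: fun_eq_iff)
  have 2: "runs (distribute w u v) ?\<sigma> (\<sigma>(v := \<sigma> u)) (8 * length (\<sigma> u) + 1)"
    using runs_distribute[of w u v ?\<sigma>] assms unfolding eq by simp
  show ?thesis
    unfolding copy_def by (rule runs_mono[OF runs_Seq[OF 1 2]]) simp
qed

text \<open>The detour over \<open>w\<close> reverses twice, so the order survives. In this way a
  value computed in scratch space overwrites an outdated one.\<close>

definition replace :: "nat \<Rightarrow> nat \<Rightarrow> nat \<Rightarrow> 'a cmd" where
  "replace u v w = Seq (clear v) (Seq (transfer u w) (transfer w v))"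

lemma runs_replace:
  assumes "distinct [u, v, w]" "\<sigma> w = []"
  shows "runs (replace u v w) \<sigma> (\<sigma>(v := \<sigma> u, u := []))
    (2 * length (\<sigma> v) + 10 * length (\<sigma> u) + 5)"
proof -
  let ?\<sigma> = "\<sigma>(v := [])" and ?\<tau> = "\<sigma>(v := [], u := [], w := rev (\<sigma> u))"
  have 1: "runs (transfer u w) ?\<sigma> ?\<tau> (5 * length (\<sigma> u) + 1)"
    using runs_transfer[of u w ?\<sigma>] assms by simp
  have eq: "?\<tau>(w := [], v := rev (?\<tau> w) @ ?\<tau> v) = \<sigma>(v := \<sigma> u, u := [])"
    using assms by (auto simp: fun_eq_iff)
  have 2: "runs (transfer w v) ?\<tau> (\<sigma>(v := \<sigma> u, u := [])) (5 * length (\<sigma> u) + 1)"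
    using runs_transfer[of w v ?\<tau>] assms unfolding eq by simp
  show ?thesis
    unfolding replace_def by (rule runs_mono[OF runs_Seq[OF runs_clear runs_Seq[OF 1 2]]]) simp
qed

section \<open>Polynomial bounds\<close>

named_theorems poly_intros

text \<open>The base \<open>n + 2\<close> is at least 2 even for \<open>n = 0\<close>, so exponents
  absorb constants and factors: a constant \<open>c\<close> is at most \<open>2 ^ c\<close>, and a
  sum of two bounds costs one further factor.\<close>

definition poly_bounded :: "(nat \<Rightarrow> nat) \<Rightarrow> bool" where
  "poly_bounded B \<longleftrightarrow> (\<exists>d. \<forall>n. B n \<le> (n + 2) ^ d)"

lemma poly_bounded_mono: "poly_bounded C \<Longrightarrow> (\<And>n. B n \<le> C n) \<Longrightarrow> poly_bounded B"
  unfolding poly_bounded_def using le_trans by blast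

lemma poly_bounded_const [poly_intros]: "poly_bounded (\<lambda>_. c)"
proof -
  have "c \<le> (n + 2) ^ c" for n
    using less_exp[of c] power_mono[of 2 "n + 2" c] by (simp add: le_trans less_imp_le_nat)
  then show ?thesis unfolding poly_bounded_def by blast
qed

lemma poly_bounded_id [poly_intros]: "poly_bounded (\<lambda>n. n)"
  unfolding poly_bounded_def by (intro exI[of _ 1]) auto

lemma poly_bounded_add [poly_intros]:
  assumes "poly_bounded B" "poly_bounded C" shows "poly_bounded (\<lambda>n. B n + C n)"
proof -
  obtain b c where bc: "B n \<le> (n + 2) ^ b" "C n \<le> (n + 2) ^ c" for n
    using assms unfolding poly_bounded_def by blast
  have "B n + C n \<le> (n + 2) ^ Suc (max b c)" for n
  proof -
    have "(n + 2) ^ b \<le> (n + 2) ^ max b c" "(n + 2) ^ c \<le> (n + 2) ^ max b c"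
      by (intro power_increasing; simp)+
    moreover have "2 * (n + 2) ^ max b c \<le> (n + 2) ^ Suc (max b c)"
      by simp
    ultimately show ?thesis
      using bc[of n] by linarith
  qed
  then show ?thesis unfolding poly_bounded_def by blast
qed

lemma poly_bounded_mult [poly_intros]:
  assumes "poly_bounded B" "poly_bounded C" shows "poly_bounded (\<lambda>n. B n * C n)"
proof -
  obtain b c where "B n \<le> (n + 2) ^ b" "C n \<le> (n + 2) ^ c" for n
    using assms unfolding poly_bounded_def by blast
  then have "B n * C n \<le> (n + 2) ^ (b + c)" for n
    by (simp only: power_add mult_mono zero_le)
  then show ?thesis unfolding poly_bounded_def by blast
qed

lemma poly_bounded_Suc [poly_intros]: "poly_bounded B \<Longrightarrow> poly_bounded (\<lambda>n. Suc (B n))"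
  using poly_bounded_add[of B "\<lambda>_. 1"] poly_bounded_const by simp

lemma poly_bounded_power: "poly_bounded B \<Longrightarrow> poly_bounded (\<lambda>n. B n ^ d)"
  by (induction d) (simp_all add: poly_intros)

lemma poly_bounded_compose:
  assumes "poly_bounded B" "poly_bounded C" shows "poly_bounded (\<lambda>n. B (C n))"
proof -
  obtain b where b: "B n \<le> (n + 2) ^ b" for n
    using assms unfolding poly_bounded_def by blast
  have "poly_bounded (\<lambda>n. (C n + 2) ^ b)"
    by (intro poly_bounded_power poly_intros assms)
  then show ?thesis
    by (rule poly_bounded_mono) (rule b)
qed

section \<open>Polynomial-time functions of a context\<close>

definition clean :: "nat \<Rightarrow> 'a store \<Rightarrow> bool" where
  "clean m \<sigma> \<longleftrightarrow> (\<forall>i\<ge>m. \<sigma> i = [])"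

definition computes ::
    "('c \<Rightarrow> 'a list) list \<Rightarrow> nat list \<Rightarrow> nat \<Rightarrow> ('c \<Rightarrow> 'a list) \<Rightarrow> 'a cmd \<Rightarrow> (nat \<Rightarrow> nat) \<Rightarrow> bool"
  where "computes V ls m f c B \<longleftrightarrow> poly_bounded B \<and>
    (\<forall>\<rho> \<sigma> N. map \<sigma> ls = map (\<lambda>v. v \<rho>) V \<and> clean m \<sigma> \<and> (\<forall>v\<in>set V. length (v \<rho>) \<le> N) \<longrightarrow>
      runs c \<sigma> (\<sigma>(m := f \<rho>)) (B N))"

text \<open>The functions in \<open>V\<close> are the variables in scope: the value of a context \<open>\<rho>\<close> is available
  to programs only through the stacks \<open>ls\<close>, which hold the values \<open>v \<rho>\<close> for \<open>v\<close> in \<open>V\<close>. Stacks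
  from \<open>m\<close> on are scratch space.\<close>

definition ptime :: "('c \<Rightarrow> 'a list) list \<Rightarrow> ('c \<Rightarrow> 'a list) \<Rightarrow> bool" where
  "ptime V f \<longleftrightarrow> (\<forall>ls m. length ls = length V \<longrightarrow> (\<forall>l\<in>set ls. l < m) \<longrightarrow>
    (\<exists>c B. computes V ls m f c B))"

lemma ptimeI:
  assumes "\<And>ls m. length ls = length V \<Longrightarrow> (\<And>l. l \<in> set ls \<Longrightarrow> l < m) \<Longrightarrow> \<exists>c B. computes V ls m f c B"
  shows "ptime V f"
  using assms unfolding ptime_def by blast

lemma ptimeE:
  assumes "ptime V f" "length ls = length V" "\<And>l. l \<in> set ls \<Longrightarrow> l < m"
  obtains c B where "computes V ls m f c B"
  using assms unfolding ptime_def by blast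

lemma computesI:
  assumes "poly_bounded B"
    and "\<And>\<rho> \<sigma> N. map \<sigma> ls = map (\<lambda>v. v \<rho>) V \<Longrightarrow> clean m \<sigma> \<Longrightarrow>
      \<forall>v\<in>set V. length (v \<rho>) \<le> N \<Longrightarrow> runs c \<sigma> (\<sigma>(m := f \<rho>)) (B N)"
  shows "computes V ls m f c B"
  using assms unfolding computes_def by blast

lemma computes_poly: "computes V ls m f c B \<Longrightarrow> poly_bounded B"
  unfolding computes_def by blast

lemma computes_runs:
  assumes "computes V ls m f c B" "map \<sigma> ls = map (\<lambda>v. v \<rho>) V" "clean m \<sigma>"
    and "\<forall>v\<in>set V. length (v \<rho>) \<le> N"
  shows "runs c \<sigma> (\<sigma>(m := f \<rho>)) (B N)"
  using assms unfolding computes_def by blast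

lemma computes_length:
  assumes "computes V ls m f c B" "map \<sigma> ls = map (\<lambda>v. v \<rho>) V" "clean m \<sigma>"
    and "\<forall>v\<in>set V. length (v \<rho>) \<le> N"
  shows "length (f \<rho>) \<le> B N"
  using length_runs_le[OF computes_runs[OF assms], of m] assms(3) by (simp add: clean_def)

lemma clean_upd: "clean m \<sigma> \<Longrightarrow> clean (Suc m) (\<sigma>(m := x))"
  by (auto simp: clean_def)

lemma map_upd_fresh:
  fixes ls :: "nat list"
  assumes "\<And>l. l \<in> set ls \<Longrightarrow> l < m"
  shows "map (\<sigma>(m := x)) ls = map \<sigma> ls"
proof (rule map_cong[OF refl])
  fix l assume "l \<in> set ls"
  then show "(\<sigma>(m := x)) l = \<sigma> l" using assms[of l] by auto
qed

text \<open>A store that displays the context is built by putting the variables on the first stacks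
  in order. The size bound is then the running time of a program for \<open>f\<close>.\<close>

lemma ptime_length:
  assumes "ptime V f"
  shows "\<exists>B. poly_bounded B \<and>
    (\<forall>\<rho> N. (\<forall>v\<in>set V. length (v \<rho>) \<le> N) \<longrightarrow> length (f \<rho>) \<le> B N)"
proof -
  obtain c B where cB: "computes V [0..<length V] (length V) f c B"
    by (rule ptimeE[OF assms, of "[0..<length V]" "length V"]) auto
  have "length (f \<rho>) \<le> B N" if "\<forall>v\<in>set V. length (v \<rho>) \<le> N" for \<rho> N
  proof (rule computes_length[OF cB _ _ that])
    let ?\<sigma> = "\<lambda>i. if i < length V then (V ! i) \<rho> else []"
    show "map ?\<sigma> [0..<length V] = map (\<lambda>v. v \<rho>) V"
      by (rule nth_equalityI) auto
    show "clean (length V) ?\<sigma>"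
      by (simp add: clean_def)
  qed
  with computes_poly[OF cB] show ?thesis by blast
qed

text \<open>\<open>ptime\<close> promises a program for every placement of variables and scratch
  space. Here the program for \<open>g\<close> is taken with stack \<open>m\<close>, which holds the
  value of \<open>f\<close>, as one more variable and with scratch space from \<open>Suc m\<close>
  on. Finally the value of \<open>g\<close> overwrites that of \<open>f\<close>.\<close>

lemma ptime_cut:
  assumes f: "ptime V f" and g: "ptime (V @ [f]) g"
  shows "ptime V g"
proof (rule ptimeI)
  fix ls :: "nat list" and m assume ls: "length ls = length V" and m: "\<And>l. l \<in> set ls \<Longrightarrow> l < m"
  obtain cf Bf where cf: "computes V ls m f cf Bf"
    using ptimeE[OF f ls m] by blast
  have ls': "length (ls @ [m]) = length (V @ [f])"
    using ls by simp
  have m': "l < Suc m" if "l \<in> set (ls @ [m])" for l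
    using m[of l] that by auto
  obtain cg Bg where cg: "computes (V @ [f]) (ls @ [m]) (Suc m) g cg Bg"
    using ptimeE[OF g ls' m'] by blast
  let ?c = "Seq cf (Seq cg (replace (Suc m) m (m + 2)))"
  \<comment> \<open>\<open>N\<close> bounds the old variables and \<open>Bf N\<close> the new one,
    so the sum bounds every input of \<open>g\<close>.\<close>
  let ?G = "\<lambda>N. Bg (N + Bf N)"
  let ?B = "\<lambda>N. Suc (Bf N + Suc (?G N + (2 * Bf N + 10 * ?G N + 5)))"
  have G: "poly_bounded ?G"
    by (rule poly_bounded_compose[where B=Bg and C="\<lambda>N. N + Bf N"])
      (intro poly_intros computes_poly[OF cf] computes_poly[OF cg])+
  have "computes V ls m g ?c ?B"
  proof (rule computesI)
    show "poly_bounded ?B"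
      by (intro poly_intros computes_poly[OF cf] G)
  next
    fix \<rho> \<sigma> N
    assume \<sigma>: "map \<sigma> ls = map (\<lambda>v. v \<rho>) V" and cl: "clean m \<sigma>"
      and N: "\<forall>v\<in>set V. length (v \<rho>) \<le> N"
    let ?\<sigma>1 = "\<sigma>(m := f \<rho>)"
    let ?\<sigma>2 = "?\<sigma>1(Suc m := g \<rho>)"
    have lf: "length (f \<rho>) \<le> Bf N"
      using computes_length[OF cf \<sigma> cl N] .
    have 1: "map ?\<sigma>1 (ls @ [m]) = map (\<lambda>v. v \<rho>) (V @ [f])"
      by (simp only: map_append map_upd_fresh[of ls m, OF m] \<sigma> list.map fun_upd_same)
    have 2: "\<forall>v\<in>set (V @ [f]). length (v \<rho>) \<le> N + Bf N"
      using lf N by auto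
    note run_g = computes_runs[OF cg 1 clean_upd[OF cl] 2]
    have lg: "length (g \<rho>) \<le> ?G N"
      using computes_length[OF cg 1 clean_upd[OF cl] 2] .
    have "?\<sigma>2(m := ?\<sigma>2 (Suc m), Suc m := []) = \<sigma>(m := g \<rho>)"
      using cl by (auto simp: clean_def fun_eq_iff)
    moreover have "?\<sigma>2 (m + 2) = []"
      using cl by (simp add: clean_def)
    ultimately have "runs (replace (Suc m) m (m + 2)) ?\<sigma>2 (\<sigma>(m := g \<rho>))
        (2 * length (f \<rho>) + 10 * length (g \<rho>) + 5)"
      using runs_replace[of "Suc m" m "m + 2" ?\<sigma>2] by simp
    then have "runs (replace (Suc m) m (m + 2)) ?\<sigma>2 (\<sigma>(m := g \<rho>)) (2 * Bf N + 10 * ?G N + 5)"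
      by (rule runs_mono) (use lf lg in simp)
    then show "runs ?c \<sigma> (\<sigma>(m := g \<rho>)) (?B N)"
      by (rule runs_Seq[OF computes_runs[OF cf \<sigma> cl N] runs_Seq[OF run_g]])
  qed
  then show "\<exists>c B. computes V ls m g c B" by blast
qed

text \<open>The program is kept and merely reads other stacks. Renaming, reordering, sharing and
  weakening of variables are all instances.\<close>

lemma ptime_reindex:
  assumes h: "ptime U h" and U: "\<And>u. u \<in> set U \<Longrightarrow> (\<lambda>\<rho>. u (\<theta> \<rho>)) \<in> set V"
  shows "ptime V (\<lambda>\<rho>. h (\<theta> \<rho>))"
proof (rule ptimeI)
  fix ls :: "nat list" and m assume ls: "length ls = length V" and m: "\<And>l. l \<in> set ls \<Longrightarrow> l < m"
  \<comment> \<open>A function may occur several times in \<open>V\<close>; any of its positions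
    serves, since they all hold the same value.\<close>
  define pos where "pos u = (SOME i. i < length V \<and> V ! i = (\<lambda>\<rho>. u (\<theta> \<rho>)))" for u
  have pos: "pos u < length V" "V ! pos u = (\<lambda>\<rho>. u (\<theta> \<rho>))" if "u \<in> set U" for u
    using someI_ex[of "\<lambda>i. i < length V \<and> V ! i = (\<lambda>\<rho>. u (\<theta> \<rho>))"] U[OF that]
    unfolding pos_def by (auto simp: in_set_conv_nth)
  let ?ls = "map (\<lambda>u. ls ! pos u) U"
  obtain c B where c: "computes U ?ls m h c B"
  proof (rule ptimeE[OF h])
    show "l < m" if "l \<in> set ?ls" for l
      using that m pos(1) ls by auto
  qed simp
  have "computes V ls m (\<lambda>\<rho>. h (\<theta> \<rho>)) c B"
  proof (rule computesI[OF computes_poly[OF c]])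
    fix \<rho> \<sigma> N
    assume \<sigma>: "map \<sigma> ls = map (\<lambda>v. v \<rho>) V" and cl: "clean m \<sigma>"
      and N: "\<forall>v\<in>set V. length (v \<rho>) \<le> N"
    have "\<sigma> (ls ! pos u) = u (\<theta> \<rho>)" if "u \<in> set U" for u
    proof -
      have "map \<sigma> ls ! pos u = map (\<lambda>v. v \<rho>) V ! pos u"
        using \<sigma> by simp
      then show ?thesis
        using pos[OF that] ls by simp
    qed
    then have "map \<sigma> ?ls = map (\<lambda>u. u (\<theta> \<rho>)) U"
      by simp
    moreover have "\<forall>u\<in>set U. length (u (\<theta> \<rho>)) \<le> N"
    proof
      fix u assume "u \<in> set U"
      from bspec[OF N U[OF this]] show "length (u (\<theta> \<rho>)) \<le> N" .
    qed
    ultimately show "runs c \<sigma> (\<sigma>(m := h (\<theta> \<rho>))) (B N)"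
      using computes_runs[OF c _ cl] by blast
  qed
  then show "\<exists>c B. computes V ls m (\<lambda>\<rho>. h (\<theta> \<rho>)) c B" by blast
qed

lemma ptime_id: "ptime [\<lambda>x::'a list. x] (\<lambda>x. x)"
proof (rule ptimeI)
  fix ls :: "nat list" and m
  assume "length ls = length [\<lambda>x::'a list. x]" and m: "\<And>l. l \<in> set ls \<Longrightarrow> l < m"
  then obtain l where l: "ls = [l]" by (cases ls) auto
  have "computes [\<lambda>x::'a list. x] ls m (\<lambda>x. x) (copy l m (Suc m)) (\<lambda>N. 13 * N + 3)"
  proof (rule computesI)
    fix \<rho> \<sigma> N
    assume "map \<sigma> ls = map (\<lambda>v. v \<rho>) [\<lambda>x::'a list. x]" "clean m \<sigma>"
      and "\<forall>v\<in>set [\<lambda>x::'a list. x]. length (v \<rho>) \<le> N"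
    then show "runs (copy l m (Suc m)) \<sigma> (\<sigma>(m := \<rho>)) (13 * N + 3)"
      using runs_mono[OF runs_copy[of l m "Suc m" \<sigma>], of "13 * N + 3"] m[of l] l
      by (simp add: clean_def)
  qed (intro poly_intros)
  then show "\<exists>c B. computes [\<lambda>x::'a list. x] ls m (\<lambda>x. x) c B" by blast
qed

lemma ptime_var: "v \<in> set V \<Longrightarrow> ptime V v"
  using ptime_reindex[OF ptime_id, of v V] by simp

lemma ptime_weaken: "ptime V f \<Longrightarrow> set V \<subseteq> set W \<Longrightarrow> ptime W f"
  using ptime_reindex[of V f "\<lambda>x. x" W] by auto

lemma ptime_comp1:
  assumes "ptime [\<lambda>x. x] h" "ptime V f"
  shows "ptime V (\<lambda>\<rho>. h (f \<rho>))"
  by (rule ptime_cut[OF assms(2)], rule ptime_reindex[OF assms(1)]) simp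

text \<open>A function of two arguments is judged in the context of the projections of a pair. The
  arguments are supplied by two cuts, the second in a context weakened by the first.\<close>

lemma ptime_comp2:
  assumes "ptime [fst, snd] (\<lambda>z. h (fst z) (snd z))" "ptime V f" "ptime V g"
  shows "ptime V (\<lambda>\<rho>. h (f \<rho>) (g \<rho>))"
proof -
  have "ptime (V @ [f] @ [g]) (\<lambda>\<rho>. (\<lambda>z. h (fst z) (snd z)) (f \<rho>, g \<rho>))"
    by (rule ptime_reindex[OF assms(1)]) auto
  moreover have "ptime (V @ [f]) g"
    by (rule ptime_weaken[OF assms(3)]) auto
  ultimately show ?thesis
    using ptime_cut[OF assms(2)] ptime_cut[of "V @ [f]" g] by simp
qed

lemma ptime_comp3:
  assumes "ptime [fst, \<lambda>z. fst (snd z), \<lambda>z. snd (snd z)] (\<lambda>z. h (fst z) (fst (snd z)) (snd (snd z)))"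
    and "ptime V f1" "ptime V f2" "ptime V f3"
  shows "ptime V (\<lambda>\<rho>. h (f1 \<rho>) (f2 \<rho>) (f3 \<rho>))"
proof -
  have "ptime (V @ [f1, f2, f3]) (\<lambda>\<rho>. (\<lambda>z. h (fst z) (fst (snd z)) (snd (snd z))) (f1 \<rho>, f2 \<rho>, f3 \<rho>))"
    by (rule ptime_reindex[OF assms(1)]) auto
  moreover have "ptime (V @ [f1, f2]) f3" "ptime (V @ [f1]) f2"
    by (rule ptime_weaken[OF assms(4)] ptime_weaken[OF assms(3)]; force)+
  ultimately show ?thesis
    using ptime_cut[OF assms(2)] ptime_cut[of "V @ [f1]" f2] ptime_cut[of "V @ [f1, f2]" f3] by simp
qed

section \<open>Elementary functions and branching\<close>

lemma ptime_Nil: "ptime V (\<lambda>_. [])"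
proof (rule ptimeI)
  fix ls :: "nat list" and m
  have "computes V ls m (\<lambda>_. []) Skip (\<lambda>_. 1)"
  proof (rule computesI)
    fix \<rho> \<sigma> N
    assume "clean m \<sigma>"
    then have "\<sigma>(m := []) = \<sigma>" by (auto simp: clean_def)
    then show "runs Skip \<sigma> (\<sigma>(m := [])) 1" by (simp only: runs_Skip)
  qed (rule poly_intros)
  then show "\<exists>c B. computes V ls m (\<lambda>_. []) c B" by blast
qed

lemma ptime_Cons:
  assumes "ptime V f" shows "ptime V (\<lambda>\<rho>. x # f \<rho>)"
proof (rule ptimeI)
  fix ls :: "nat list" and m assume ls: "length ls = length V" and m: "\<And>l. l \<in> set ls \<Longrightarrow> l < m"
  obtain c B where c: "computes V ls m f c B"
    using ptimeE[OF assms ls m] by blast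
  have "computes V ls m (\<lambda>\<rho>. x # f \<rho>) (Seq c (Push m x)) (\<lambda>N. Suc (B N + 2))"
  proof (rule computesI)
    show "poly_bounded (\<lambda>N. Suc (B N + 2))" by (intro poly_intros computes_poly[OF c])
  next
    fix \<rho> \<sigma> N
    assume *: "map \<sigma> ls = map (\<lambda>v. v \<rho>) V" "clean m \<sigma>" "\<forall>v\<in>set V. length (v \<rho>) \<le> N"
    show "runs (Seq c (Push m x)) \<sigma> (\<sigma>(m := x # f \<rho>)) (Suc (B N + 2))"
      using runs_Seq[OF computes_runs[OF c *] runs_Push[of m x]] by simp
  qed
  then show "\<exists>c B. computes V ls m (\<lambda>\<rho>. x # f \<rho>) c B" by blast
qed

lemma ptime_tl:
  assumes "ptime V f" shows "ptime V (\<lambda>\<rho>. tl (f \<rho>))"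
proof (rule ptimeI)
  fix ls :: "nat list" and m assume ls: "length ls = length V" and m: "\<And>l. l \<in> set ls \<Longrightarrow> l < m"
  obtain c B where c: "computes V ls m f c B"
    using ptimeE[OF assms ls m] by blast
  have "computes V ls m (\<lambda>\<rho>. tl (f \<rho>)) (Seq c (Pop m)) (\<lambda>N. Suc (B N + 1))"
  proof (rule computesI)
    show "poly_bounded (\<lambda>N. Suc (B N + 1))" by (intro poly_intros computes_poly[OF c])
  next
    fix \<rho> \<sigma> N
    assume *: "map \<sigma> ls = map (\<lambda>v. v \<rho>) V" "clean m \<sigma>" "\<forall>v\<in>set V. length (v \<rho>) \<le> N"
    show "runs (Seq c (Pop m)) \<sigma> (\<sigma>(m := tl (f \<rho>))) (Suc (B N + 1))"
      using runs_Seq[OF computes_runs[OF c *] runs_Pop[of m]] by simp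
  qed
  then show "\<exists>c B. computes V ls m (\<lambda>\<rho>. tl (f \<rho>)) c B" by blast
qed

text \<open>The basic step for building a list from symbols that are not fixed in the program.
  \<open>g\<close> is evaluated first, so that its value already lies where the answer belongs and
  the top of \<open>f\<close> is duplicated onto it.\<close>

lemma ptime_append_peek:
  assumes f: "ptime V f" and g: "ptime V g" shows "ptime V (\<lambda>\<rho>. take 1 (f \<rho>) @ g \<rho>)"
proof (rule ptimeI)
  fix ls :: "nat list" and m assume ls: "length ls = length V" and m: "\<And>l. l \<in> set ls \<Longrightarrow> l < m"
  obtain cg Bg where cg: "computes V ls m g cg Bg"
    using ptimeE[OF g ls m] by blast
  obtain cf Bf where cf: "computes V ls (Suc m) f cf Bf"
    using ptimeE[OF f ls, of "Suc m"] m less_SucI by blast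
  let ?d = "Cond (Suc m) nonempty (Seq (Dup (Suc m) m) (clear (Suc m))) Skip"
  let ?c = "Seq cg (Seq cf ?d)"
  let ?B = "\<lambda>N. Suc (Bg N + Suc (Bf N + Suc (Suc (2 + (2 * Bf N + 1)))))"
  have "computes V ls m (\<lambda>\<rho>. take 1 (f \<rho>) @ g \<rho>) ?c ?B"
  proof (rule computesI)
    show "poly_bounded ?B"
      by (intro poly_intros computes_poly[OF cf] computes_poly[OF cg])
  next
    fix \<rho> \<sigma> N
    assume *: "map \<sigma> ls = map (\<lambda>v. v \<rho>) V" "clean m \<sigma>" "\<forall>v\<in>set V. length (v \<rho>) \<le> N"
    let ?\<sigma>1 = "\<sigma>(m := g \<rho>)"
    let ?\<sigma>2 = "?\<sigma>1(Suc m := f \<rho>)" and ?\<sigma>3 = "\<sigma>(m := take 1 (f \<rho>) @ g \<rho>)"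
    have 1: "map ?\<sigma>1 ls = map (\<lambda>v. v \<rho>) V"
      by (simp only: map_upd_fresh[of ls m, OF m] *(1))
    note run_f = computes_runs[OF cf 1 clean_upd[OF *(2)] *(3)]
    have lf: "length (f \<rho>) \<le> Bf N"
      using computes_length[OF cf 1 clean_upd[OF *(2)] *(3)] .
    have "runs ?d ?\<sigma>2 ?\<sigma>3 (Suc (Suc (2 + (2 * Bf N + 1))))"
    proof (cases "f \<rho> = []")
      case True
      then have eq: "?\<sigma>3 = ?\<sigma>2" using *(2) by (auto simp: clean_def fun_eq_iff)
      have "runs ?d ?\<sigma>2 ?\<sigma>3 (Suc 1)"
        unfolding eq by (rule runs_CondF[OF _ runs_Skip]) (use True in simp)
      then show ?thesis by (rule runs_mono) simp
    next
      case False
      let ?\<tau> = "?\<sigma>2(m := hd (f \<rho>) # g \<rho>)"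
      have D: "runs (Dup (Suc m) m) ?\<sigma>2 ?\<tau> 2"
        using runs_Dup[of ?\<sigma>2 "Suc m" m] False by simp
      have "?\<tau>(Suc m := []) = ?\<sigma>3"
        using *(2) False by (cases "f \<rho>") (auto simp: clean_def fun_eq_iff)
      then have "runs (clear (Suc m)) ?\<tau> ?\<sigma>3 (2 * length (f \<rho>) + 1)"
        using runs_clear[of "Suc m" ?\<tau>] by simp
      then have Cl: "runs (clear (Suc m)) ?\<tau> ?\<sigma>3 (2 * Bf N + 1)"
        by (rule runs_mono) (use lf in simp)
      show ?thesis
        by (rule runs_CondT[OF _ runs_Seq[OF D Cl]]) (use False in simp)
    qed
    then show "runs ?c \<sigma> ?\<sigma>3 (?B N)"
      by (rule runs_Seq[OF computes_runs[OF cg *] runs_Seq[OF run_f]])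
  qed
  then show "\<exists>c B. computes V ls m (\<lambda>\<rho>. take 1 (f \<rho>) @ g \<rho>) c B" by blast
qed

text \<open>The tested value is cleared at the start of either branch, so that both run from the
  original store.\<close>

lemma ptime_if_peek:
  assumes f: "ptime V f" and g: "ptime V g" and h: "ptime V h"
  shows "ptime V (\<lambda>\<rho>. if P (peek (f \<rho>)) then g \<rho> else h \<rho>)"
proof (rule ptimeI)
  fix ls :: "nat list" and m assume ls: "length ls = length V" and m: "\<And>l. l \<in> set ls \<Longrightarrow> l < m"
  obtain cf Bf where cf: "computes V ls m f cf Bf"
    using ptimeE[OF f ls m] by blast
  obtain cg Bg where cg: "computes V ls m g cg Bg"
    using ptimeE[OF g ls m] by blast
  obtain ch Bh where ch: "computes V ls m h ch Bh"
    using ptimeE[OF h ls m] by blast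
  let ?d = "Cond m P (Seq (clear m) cg) (Seq (clear m) ch)"
  let ?c = "Seq cf ?d"
  let ?D = "\<lambda>N. Suc (Suc ((2 * Bf N + 1) + (Bg N + Bh N)))"
  let ?B = "\<lambda>N. Suc (Bf N + ?D N)"
  let ?r = "\<lambda>\<rho>. if P (peek (f \<rho>)) then g \<rho> else h \<rho>"
  have "computes V ls m ?r ?c ?B"
  proof (rule computesI)
    show "poly_bounded ?B"
      by (intro poly_intros computes_poly[OF cf] computes_poly[OF cg] computes_poly[OF ch])
  next
    fix \<rho> \<sigma> N
    assume *: "map \<sigma> ls = map (\<lambda>v. v \<rho>) V" "clean m \<sigma>" "\<forall>v\<in>set V. length (v \<rho>) \<le> N"
    let ?\<sigma> = "\<sigma>(m := f \<rho>)"
    have lf: "length (f \<rho>) \<le> Bf N"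
      using computes_length[OF cf *] .
    have "\<sigma>(m := []) = \<sigma>"
      using *(2) by (auto simp: clean_def)
    then have "runs (clear m) ?\<sigma> \<sigma> (2 * length (f \<rho>) + 1)"
      using runs_clear[of m ?\<sigma>] by simp
    then have cl: "runs (clear m) ?\<sigma> \<sigma> (2 * Bf N + 1)"
      by (rule runs_mono) (use lf in simp)
    have "runs ?d ?\<sigma> (\<sigma>(m := ?r \<rho>)) (?D N)"
    proof (cases "P (peek (f \<rho>))")
      case True
      then have "runs ?d ?\<sigma> (\<sigma>(m := ?r \<rho>)) (Suc (Suc ((2 * Bf N + 1) + Bg N)))"
        using runs_CondT[of P ?\<sigma> m, OF _ runs_Seq[OF cl computes_runs[OF cg *]]] by simp
      then show ?thesis by (rule runs_mono) simp
    next
      case False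
      then have "runs ?d ?\<sigma> (\<sigma>(m := ?r \<rho>)) (Suc (Suc ((2 * Bf N + 1) + Bh N)))"
        using runs_CondF[of P ?\<sigma> m, OF _ runs_Seq[OF cl computes_runs[OF ch *]]] by simp
      then show ?thesis by (rule runs_mono) simp
    qed
    then show "runs ?c \<sigma> (\<sigma>(m := ?r \<rho>)) (?B N)"
      by (rule runs_Seq[OF computes_runs[OF cf *]])
  qed
  then show "\<exists>c B. computes V ls m ?r c B" by blast
qed

section \<open>Iteration\<close>

text \<open>The list of the nonempty iterates of \<open>g\<close>, for functions \<open>g\<close> that shorten nonempty lists;
  the test only ensures termination.\<close>

function iterates :: "('a list \<Rightarrow> 'a list) \<Rightarrow> 'a list \<Rightarrow> 'a list list" where
  "iterates g s = (if s = [] then [] else s # iterates g (if length (g s) < length s then g s else []))"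
  by auto
termination by (relation "measure (\<lambda>(g, s). length s)") auto

declare iterates.simps [simp del]

definition shortens :: "('a list \<Rightarrow> 'a list) \<Rightarrow> bool" where
  "shortens g \<longleftrightarrow> (\<forall>s. s \<noteq> [] \<longrightarrow> length (g s) < length s)"

lemma iterates_Nil [simp]: "iterates g [] = []"
  by (simp add: iterates.simps)

lemma iterates_step: "shortens g \<Longrightarrow> s \<noteq> [] \<Longrightarrow> iterates g s = s # iterates g (g s)"
  by (subst iterates.simps) (simp add: shortens_def)

lemma length_iterates_le: "length (iterates g s) \<le> length s"
proof (induction g s rule: iterates.induct)
  case (1 g s)
  show ?case
  proof (cases "s = []")
    case False
    have "length (iterates g (if length (g s) < length s then g s else [])) < length s"
      using 1[OF False] False by (auto split: if_splits)
    with False show ?thesis by (subst iterates.simps) simp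
  qed simp
qed

lemma in_iterates_length_le: "t \<in> set (iterates g s) \<Longrightarrow> length t \<le> length s"
proof (induction g s rule: iterates.induct)
  case (1 g s)
  show ?case
  proof (cases "s = []")
    case False
    then have "t = s \<or> t \<in> set (iterates g (if length (g s) < length s then g s else []))"
      using "1.prems" by (subst (asm) iterates.simps) simp
    then show ?thesis
      using "1.IH"[OF False] by (auto split: if_splits)
  qed (use "1.prems" in simp)
qed

text \<open>Binders: a context is paired with the values bound by a quantifier or a fold, and the
  old variables read the first component. \<open>bind1\<close> adds the current suffix as a
  variable, \<open>bind2\<close> the accumulator and the suffix.\<close>

abbreviation bind1 :: "('c \<Rightarrow> 'a list) list \<Rightarrow> ('c \<times> 'a list \<Rightarrow> 'a list) list" where
  "bind1 V \<equiv> map (\<lambda>v z. v (fst z)) V @ [snd]"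

abbreviation bind2 :: "('c \<Rightarrow> 'a list) list \<Rightarrow> ('c \<times> 'a list \<times> 'a list \<Rightarrow> 'a list) list" where
  "bind2 V \<equiv> map (\<lambda>v z. v (fst z)) V @ [\<lambda>z. fst (snd z), \<lambda>z. snd (snd z)]"

text \<open>Invariant: stack \<open>m\<close> holds the accumulator and \<open>Suc m\<close> the
  rest of the list, which every round shortens. \<open>take j\<close> restricts the size bound to
  accumulators that occur during the run. Each of the two replacements in a round costs at most
  \<open>12 * M + 5\<close>; what is left of the 20 covers \<open>Seq\<close> and
  \<open>Loop\<close>.\<close>

lemma runs_fold_loop:
  assumes g: "shortens g" and \<sigma>: "clean m \<sigma>" "map \<sigma> ls = map (\<lambda>v. v \<rho>) V"
    and ls: "\<And>l. l \<in> set ls \<Longrightarrow> l < m"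
    and cF: "computes (bind2 V) (ls @ [m, Suc m]) (m + 2) (\<lambda>z. F (fst z) (fst (snd z)) (snd (snd z))) cF BF"
    and cG: "computes [\<lambda>x. x] [Suc m] (m + 2) g cG BG"
    and V: "\<forall>v\<in>set V. length (v \<rho>) \<le> M"
    and a: "\<And>j. length (foldl (F \<rho>) a (take j (iterates g s))) \<le> M" and s: "length s \<le> M"
  shows "runs
    (Loop (Suc m) nonempty (Seq cF (Seq (replace (m + 2) m (m + 3)) (Seq cG (replace (m + 2) (Suc m) (m + 3))))))
    (\<sigma>(m := a, Suc m := s)) (\<sigma>(m := foldl (F \<rho>) a (iterates g s)))
    (length s * (BF M + BG M + 24 * M + 20) + 1)"
    (is "runs (Loop _ _ ?body) _ _ (_ * ?K + 1)")
  using a s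
proof (induction s arbitrary: a rule: length_induct)
  case (1 s)
  let ?\<sigma> = "\<sigma>(m := a, Suc m := s)"
  show ?case
  proof (cases "s = []")
    case True
    have eq: "\<sigma>(m := foldl (F \<rho>) a (iterates g s)) = ?\<sigma>"
      using \<sigma>(1) True by (auto simp: clean_def fun_eq_iff)
    show ?thesis
      unfolding eq by (rule runs_mono[OF runs_LoopF]) (use True in simp_all)
  next
    case False
    let ?a = "F \<rho> a s"
    note iterates = iterates_step[OF g False]
    have shorter: "length (g s) < length s"
      using g False by (simp add: shortens_def)
    have la: "length a \<le> M" and la': "length ?a \<le> M"
      using "1.prems"(1)[of 0] "1.prems"(1)[of 1] by (simp_all add: iterates)
    have pre: "length (foldl (F \<rho>) ?a (take j (iterates g (g s)))) \<le> M" for j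
      using "1.prems"(1)[of "Suc j"] by (simp add: iterates)
    have IH: "runs (Loop (Suc m) nonempty ?body) (\<sigma>(m := ?a, Suc m := g s))
        (\<sigma>(m := foldl (F \<rho>) a (iterates g s))) (length (g s) * ?K + 1)"
      using "1.IH"[rule_format, OF shorter pre] shorter "1.prems"(2) by (simp add: iterates)
    have fresh: "map ?\<sigma> ls = map \<sigma> ls"
      by (rule map_cong[OF refl]) (auto dest: ls)
    have 1: "map ?\<sigma> (ls @ [m, Suc m]) = map (\<lambda>v. v (\<rho>, a, s)) (bind2 V)"
      by (simp add: fresh \<sigma>(2) del: fun_upd_apply) simp
    have cl: "clean (m + 2) ?\<sigma>"
      using \<sigma>(1) by (simp add: clean_def)
    have bound: "\<forall>v\<in>set (bind2 V). length (v (\<rho>, a, s)) \<le> M"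
      using V la "1.prems"(2) by auto
    have run_F: "runs cF ?\<sigma> (?\<sigma>(m + 2 := ?a)) (BF M)"
      using computes_runs[OF cF 1 cl bound] by simp
    have "(?\<sigma>(m + 2 := ?a))(m := ?a, m + 2 := []) = \<sigma>(m := ?a, Suc m := s)"
      using \<sigma>(1) by (auto simp: clean_def fun_eq_iff)
    then have "runs (replace (m + 2) m (m + 3)) (?\<sigma>(m + 2 := ?a)) (\<sigma>(m := ?a, Suc m := s))
        (2 * length a + 10 * length ?a + 5)"
      using runs_replace[of "m + 2" m "m + 3" "?\<sigma>(m + 2 := ?a)"] \<sigma>(1) by (simp add: clean_def)
    then have rep1: "runs (replace (m + 2) m (m + 3)) (?\<sigma>(m + 2 := ?a)) (\<sigma>(m := ?a, Suc m := s))
        (12 * M + 5)"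
      by (rule runs_mono) (use la la' in simp)
    let ?\<tau> = "\<sigma>(m := ?a, Suc m := s)"
    have cl': "clean (m + 2) ?\<tau>"
      using \<sigma>(1) by (simp add: clean_def)
    have run_G: "runs cG ?\<tau> (?\<tau>(m + 2 := g s)) (BG M)"
      by (rule computes_runs[OF cG _ cl']) (use "1.prems"(2) in simp_all)
    have "(?\<tau>(m + 2 := g s))(Suc m := g s, m + 2 := []) = \<sigma>(m := ?a, Suc m := g s)"
      using \<sigma>(1) by (auto simp: clean_def fun_eq_iff)
    then have "runs (replace (m + 2) (Suc m) (m + 3)) (?\<tau>(m + 2 := g s)) (\<sigma>(m := ?a, Suc m := g s))
        (2 * length s + 10 * length (g s) + 5)"
      using runs_replace[of "m + 2" "Suc m" "m + 3" "?\<tau>(m + 2 := g s)"] \<sigma>(1)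
      by (simp add: clean_def)
    then have rep2: "runs (replace (m + 2) (Suc m) (m + 3)) (?\<tau>(m + 2 := g s))
        (\<sigma>(m := ?a, Suc m := g s)) (12 * M + 5)"
      by (rule runs_mono) (use shorter "1.prems"(2) in simp)
    have "nonempty (peek (?\<sigma> (Suc m)))"
      using False by simp
    note runs_LoopT[OF this runs_Seq[OF run_F runs_Seq[OF rep1 runs_Seq[OF run_G rep2]]] IH]
    moreover have "?K + length (g s) * ?K \<le> length s * ?K"
      using mult_le_mono1[of "Suc (length (g s))" "length s" ?K] shorter by simp
    ultimately show ?thesis
      by (elim runs_mono) simp
  qed
qed

lemma ptime_fold:
  assumes l: "ptime V l" and i: "ptime V i" and G: "ptime [\<lambda>x. x] g" "shortens g"
    and F: "ptime (bind2 V) (\<lambda>z. F (fst z) (fst (snd z)) (snd (snd z)))"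
    and C: "poly_bounded C"
      "\<And>\<rho> N j. \<forall>v\<in>set V. length (v \<rho>) \<le> N \<Longrightarrow>
        length (foldl (F \<rho>) (i \<rho>) (take j (iterates g (l \<rho>)))) \<le> C N"
  shows "ptime V (\<lambda>\<rho>. foldl (F \<rho>) (i \<rho>) (iterates g (l \<rho>)))"
proof (rule ptimeI)
  fix ls :: "nat list" and m assume ls: "length ls = length V" and m: "\<And>l. l \<in> set ls \<Longrightarrow> l < m"
  obtain ci Bi where ci: "computes V ls m i ci Bi"
    using ptimeE[OF i ls m] by blast
  have m': "k < Suc m" if "k \<in> set ls" for k
    using m[OF that] by simp
  obtain cl Bl where cl: "computes V ls (Suc m) l cl Bl"
    using ptimeE[OF l ls m'] by blast
  have len: "length (ls @ [m, Suc m]) = length (bind2 V)"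
    using ls by simp
  have m2: "k < m + 2" if "k \<in> set (ls @ [m, Suc m])" for k
    using m[of k] that by auto
  obtain cF BF where cF: "computes (bind2 V) (ls @ [m, Suc m]) (m + 2)
      (\<lambda>z. F (fst z) (fst (snd z)) (snd (snd z))) cF BF"
    using ptimeE[OF F len m2] by blast
  obtain cG BG where cG: "computes [\<lambda>x. x] [Suc m] (m + 2) g cG BG"
    by (rule ptimeE[OF G(1), of "[Suc m]" "m + 2"]) auto
  let ?loop = "Loop (Suc m) nonempty
    (Seq cF (Seq (replace (m + 2) m (m + 3)) (Seq cG (replace (m + 2) (Suc m) (m + 3)))))"
  let ?c = "Seq ci (Seq cl ?loop)"
  let ?M = "\<lambda>N. N + C N + Bl N"
  let ?B = "\<lambda>N. Suc (Bi N + Suc (Bl N + (Bl N * (BF (?M N) + BG (?M N) + 24 * ?M N + 20) + 1)))"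
  have M: "poly_bounded ?M"
    by (intro poly_intros C computes_poly[OF cl])
  have "computes V ls m (\<lambda>\<rho>. foldl (F \<rho>) (i \<rho>) (iterates g (l \<rho>))) ?c ?B"
  proof (rule computesI)
    show "poly_bounded ?B"
      by (intro poly_intros C computes_poly[OF cl] computes_poly[OF ci]
          poly_bounded_compose[OF computes_poly[OF cF] M]
          poly_bounded_compose[OF computes_poly[OF cG] M])
  next
    fix \<rho> \<sigma> N
    assume *: "map \<sigma> ls = map (\<lambda>v. v \<rho>) V" "clean m \<sigma>" "\<forall>v\<in>set V. length (v \<rho>) \<le> N"
    let ?\<sigma> = "\<sigma>(m := i \<rho>)"
    have 1: "map ?\<sigma> ls = map (\<lambda>v. v \<rho>) V"
      by (simp only: map_upd_fresh[of ls m, OF m] *(1))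
    note run_l = computes_runs[OF cl 1 clean_upd[OF *(2)] *(3)]
    have ll: "length (l \<rho>) \<le> Bl N"
      using computes_length[OF cl 1 clean_upd[OF *(2)] *(3)] .
    have VM: "\<forall>v\<in>set V. length (v \<rho>) \<le> ?M N"
      using *(3) by (auto intro: trans_le_add1)
    have aM: "length (foldl (F \<rho>) (i \<rho>) (take j (iterates g (l \<rho>)))) \<le> ?M N" for j
      using C(2)[OF *(3), of j] by simp
    have lM: "length (l \<rho>) \<le> ?M N"
      using ll by simp
    have "runs ?loop (\<sigma>(m := i \<rho>, Suc m := l \<rho>))
        (\<sigma>(m := foldl (F \<rho>) (i \<rho>) (iterates g (l \<rho>))))
        (length (l \<rho>) * (BF (?M N) + BG (?M N) + 24 * ?M N + 20) + 1)"
      using runs_fold_loop[OF G(2) *(2,1) m cF cG VM aM lM] by blast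
    then have loop: "runs ?loop (\<sigma>(m := i \<rho>, Suc m := l \<rho>))
        (\<sigma>(m := foldl (F \<rho>) (i \<rho>) (iterates g (l \<rho>))))
        (Bl N * (BF (?M N) + BG (?M N) + 24 * ?M N + 20) + 1)"
      by (rule runs_mono) (use ll in simp)
    show "runs ?c \<sigma> (\<sigma>(m := foldl (F \<rho>) (i \<rho>) (iterates g (l \<rho>)))) (?B N)"
      by (rule runs_Seq[OF computes_runs[OF ci *] runs_Seq[OF run_l loop]])
  qed
  then show "\<exists>c B. computes V ls m (\<lambda>\<rho>. foldl (F \<rho>) (i \<rho>) (iterates g (l \<rho>))) c B" by blast
qed

lemma length_foldl_le:
  assumes "\<And>a x. x \<in> set xs \<Longrightarrow> length (f a x) \<le> length a + k"
  shows "length (foldl f a xs) \<le> length a + length xs * k"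
  using assms
proof (induction xs arbitrary: a)
  case (Cons x xs)
  then have "length (foldl f (f a x) xs) \<le> length (f a x) + length xs * k" by simp
  then show ?case using Cons.prems[of x a] by simp
qed simp

text \<open>If the growth in a step is independent of the accumulator, it adds up to at most
  \<open>length (l \<rho>)\<close> times the growth in one step, because there are no more iterates
  than symbols. Growth in proportion to the accumulator could be exponential.\<close>

lemma ptime_fold_growth:
  assumes l: "ptime V l" and i: "ptime V i" and G: "ptime [\<lambda>x. x] g" "shortens g"
    and F: "ptime (bind2 V) (\<lambda>z. F (fst z) (fst (snd z)) (snd (snd z)))"
    and C: "poly_bounded C"
      "\<And>\<rho> N a s. \<forall>v\<in>set V. length (v \<rho>) \<le> N \<Longrightarrow> length s \<le> length (l \<rho>) \<Longrightarrow>
        length (F \<rho> a s) \<le> length a + C N"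
  shows "ptime V (\<lambda>\<rho>. foldl (F \<rho>) (i \<rho>) (iterates g (l \<rho>)))"
proof -
  obtain Bl where Bl: "poly_bounded Bl" 
      "\<forall>\<rho> N. (\<forall>v\<in>set V. length (v \<rho>) \<le> N) \<longrightarrow> length (l \<rho>) \<le> Bl N"
    using ptime_length[OF l] by blast
  obtain Bi where Bi: "poly_bounded Bi" 
      "\<forall>\<rho> N. (\<forall>v\<in>set V. length (v \<rho>) \<le> N) \<longrightarrow> length (i \<rho>) \<le> Bi N"
    using ptime_length[OF i] by blast
  show ?thesis
  proof (rule ptime_fold[OF l i G F])
    show "poly_bounded (\<lambda>N. Bi N + Bl N * C N)"
      by (intro poly_intros Bi Bl C)
  next
    fix \<rho> N j assume V: "\<forall>v\<in>set V. length (v \<rho>) \<le> N"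
    have "length (foldl (F \<rho>) (i \<rho>) (take j (iterates g (l \<rho>)))) \<le>
        length (i \<rho>) + length (take j (iterates g (l \<rho>))) * C N"
    proof (rule length_foldl_le)
      fix a s assume "s \<in> set (take j (iterates g (l \<rho>)))"
      then show "length (F \<rho> a s) \<le> length a + C N"
        by (intro C(2)[OF V] in_iterates_length_le) (rule in_set_takeD)
    qed
    also have "length (l \<rho>) \<le> Bl N" "length (i \<rho>) \<le> Bi N"
      using Bl(2) Bi(2) V by blast+
    then have "length (i \<rho>) + length (take j (iterates g (l \<rho>))) * C N \<le> Bi N + Bl N * C N"
      using length_iterates_le[of g "l \<rho>"]
      by (intro add_mono mult_le_mono1) simp_all
    finally show "length (foldl (F \<rho>) (i \<rho>) (take j (iterates g (l \<rho>)))) \<le> Bi N + Bl N * C N" .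
  qed
qed

section \<open>Predicates and list functions\<close>

text \<open>Truth is nonemptiness, in accordance with the acceptance test on stack 1;
  \<open>undefined\<close> supplies a symbol of any alphabet.\<close>

definition flag :: "bool \<Rightarrow> 'a list" where
  "flag b = (if b then [undefined] else [])"

lemma flag_simps [simp]: "flag True = [undefined]" "flag False = []" "flag b = [] \<longleftrightarrow> \<not> b"
  by (auto simp: flag_def)

definition pdec :: "('c \<Rightarrow> 'a list) list \<Rightarrow> ('c \<Rightarrow> bool) \<Rightarrow> bool" where
  "pdec V P \<longleftrightarrow> ptime V (\<lambda>\<rho>. flag (P \<rho>))"

lemma ptime_const: "ptime V (\<lambda>_. xs)"
  by (induction xs) (auto intro: ptime_Nil ptime_Cons)

lemma pdec_peek: "ptime V f \<Longrightarrow> pdec V (\<lambda>\<rho>. P (peek (f \<rho>)))"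
  using ptime_if_peek[of V f "\<lambda>_. [undefined]" "\<lambda>_. []" P] unfolding pdec_def flag_def
  by (simp add: ptime_const)

lemma ptime_if:
  assumes "pdec V P" "ptime V f" "ptime V g"
  shows "ptime V (\<lambda>\<rho>. if P \<rho> then f \<rho> else g \<rho>)"
  using ptime_if_peek[OF assms(1)[unfolded pdec_def] assms(2,3), of nonempty] by simp

lemma pdec_if:
  assumes "pdec V P" "pdec V Q" "pdec V R"
  shows "pdec V (\<lambda>\<rho>. if P \<rho> then Q \<rho> else R \<rho>)"
  using ptime_if[OF assms(1) assms(2,3)[unfolded pdec_def]] unfolding pdec_def
  by (simp add: if_distrib)

lemma pdec_const: "pdec V (\<lambda>_. b)"
  by (simp add: pdec_def ptime_const)

lemma pdec_cong: "pdec V P \<Longrightarrow> (\<And>\<rho>. P \<rho> \<longleftrightarrow> Q \<rho>) \<Longrightarrow> pdec V Q"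
  using ext[of P Q] by simp

lemma pdec_not: "pdec V P \<Longrightarrow> pdec V (\<lambda>\<rho>. \<not> P \<rho>)"
  by (rule pdec_cong[OF pdec_if[OF _ pdec_const[of V False] pdec_const[of V True]]]) auto

lemma pdec_conj: "pdec V P \<Longrightarrow> pdec V Q \<Longrightarrow> pdec V (\<lambda>\<rho>. P \<rho> \<and> Q \<rho>)"
  by (rule pdec_cong[OF pdec_if[of V P Q, OF _ _ pdec_const[of V False]]]) auto

lemma pdec_disj: "pdec V P \<Longrightarrow> pdec V Q \<Longrightarrow> pdec V (\<lambda>\<rho>. P \<rho> \<or> Q \<rho>)"
  by (rule pdec_cong[OF pdec_if[of V P _ Q, OF _ pdec_const[of V True]]]) auto

lemma pdec_imp: "pdec V P \<Longrightarrow> pdec V Q \<Longrightarrow> pdec V (\<lambda>\<rho>. P \<rho> \<longrightarrow> Q \<rho>)"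
  by (rule pdec_cong[OF pdec_if[of V P Q, OF _ _ pdec_const[of V True]]]) auto

lemma pdec_nonempty: "ptime V f \<Longrightarrow> pdec V (\<lambda>\<rho>. f \<rho> \<noteq> [])"
  using pdec_peek[of V f nonempty] by simp

lemma pdec_empty: "ptime V f \<Longrightarrow> pdec V (\<lambda>\<rho>. f \<rho> = [])"
  using pdec_peek[of V f "\<lambda>h. h = None"] by simp

lemma pdec_reindex:
  assumes "pdec U P" "\<And>u. u \<in> set U \<Longrightarrow> (\<lambda>\<rho>. u (\<theta> \<rho>)) \<in> set V"
  shows "pdec V (\<lambda>\<rho>. P (\<theta> \<rho>))"
  unfolding pdec_def by (rule ptime_reindex[OF assms(1)[unfolded pdec_def] assms(2)])

lemma pdec_comp2:
  assumes "pdec [fst, snd] (\<lambda>z. P (fst z) (snd z))" "ptime V f" "ptime V g"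
  shows "pdec V (\<lambda>\<rho>. P (f \<rho>) (g \<rho>))"
  using ptime_comp2[OF assms(1)[unfolded pdec_def] assms(2,3)] by (simp add: pdec_def)

lemma pdec_comp3:
  assumes "pdec [fst, \<lambda>z. fst (snd z), \<lambda>z. snd (snd z)] (\<lambda>z. P (fst z) (fst (snd z)) (snd (snd z)))"
    and "ptime V f1" "ptime V f2" "ptime V f3"
  shows "pdec V (\<lambda>\<rho>. P (f1 \<rho>) (f2 \<rho>) (f3 \<rho>))"
  using ptime_comp3[OF assms(1)[unfolded pdec_def] assms(2-4)] by (simp add: pdec_def)

lemma foldl_exists: "foldl (\<lambda>a s. if Q s then [x] else a) a xs = (if \<exists>s\<in>set xs. Q s then [x] else a)"
  by (induction xs arbitrary: a) auto

text \<open>The accumulator of the fold is a flag that is raised at a witness and never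
  lowered.\<close>

lemma pdec_ex:
  assumes g: "ptime [\<lambda>x. x] g" "shortens g" and l: "ptime V l"
    and Q: "pdec (bind1 V) (\<lambda>z. Q (fst z) (snd z))"
  shows "pdec V (\<lambda>\<rho>. \<exists>s\<in>set (iterates g (l \<rho>)). Q \<rho> s)"
proof -
  let ?F = "\<lambda>\<rho> a s. if Q \<rho> s then [undefined] else a"
  have "pdec (bind2 V) (\<lambda>z. Q (fst (fst z, snd (snd z))) (snd (fst z, snd (snd z))))"
    by (rule pdec_reindex[OF Q]) auto
  then have "ptime (bind2 V) (\<lambda>z. ?F (fst z) (fst (snd z)) (snd (snd z)))"
    by (intro ptime_if ptime_const ptime_var) simp_all
  then have "ptime V (\<lambda>\<rho>. foldl (?F \<rho>) [] (iterates g (l \<rho>)))"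
  proof (rule ptime_fold_growth[OF l ptime_const g])
    show "poly_bounded (\<lambda>_. 1)" by (rule poly_bounded_const)
  qed simp
  then show ?thesis
    by (simp add: foldl_exists pdec_def flag_def)
qed

lemma pdec_all:
  assumes "ptime [\<lambda>x. x] g" "shortens g" "ptime V l" "pdec (bind1 V) (\<lambda>z. Q (fst z) (snd z))"
  shows "pdec V (\<lambda>\<rho>. \<forall>s\<in>set (iterates g (l \<rho>)). Q \<rho> s)"
  using pdec_not[OF pdec_ex[OF assms(1-3) pdec_not[OF assms(4)]]] by simp

lemma pdec_ex_finite:
  assumes "finite A" "\<And>x. x \<in> A \<Longrightarrow> pdec V (P x)"
  shows "pdec V (\<lambda>\<rho>. \<exists>x\<in>A. P x \<rho>)"
  using assms by (induction A rule: finite_induct) (auto intro: pdec_disj pdec_const)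

text \<open>A program tests one stack at a time against a fixed predicate. Over a finite alphabet
  two tops can be compared by trying every common value, including the absence of a symbol.\<close>

lemma pdec_eq_peek:
  fixes f g :: "'c \<Rightarrow> 'a::finite list"
  assumes "ptime V f" "ptime V g" shows "pdec V (\<lambda>\<rho>. peek (f \<rho>) = peek (g \<rho>))"
proof -
  have "pdec V (\<lambda>\<rho>. \<exists>x\<in>UNIV. peek (f \<rho>) = x \<and> x = peek (g \<rho>))"
    by (intro pdec_ex_finite pdec_conj pdec_peek[where P="\<lambda>h. h = _"] pdec_peek[where P="\<lambda>h. _ = h"] assms finite_class.finite_UNIV)
  then show ?thesis by simp
qed

lemma shortens_tl: "shortens tl"
  by (simp add: shortens_def)

text \<open>A step that looks only at the tops of the suffixes sees the elements one by one.\<close>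

lemma foldl_iterates_tl:
  assumes "\<And>a x xs. F a (x # xs) = h a x" shows "foldl F a (iterates tl xs) = foldl h a xs"
  by (induction xs arbitrary: a) (simp_all add: iterates_step shortens_tl assms)

lemma ptime_rev:
  assumes "ptime V f" shows "ptime V (\<lambda>\<rho>. rev (f \<rho>))"
proof -
  have "ptime V (\<lambda>\<rho>. foldl (\<lambda>a s. take 1 s @ a) [] (iterates tl (f \<rho>)))"
    by (rule ptime_fold_growth[OF assms ptime_const ptime_tl[OF ptime_id] shortens_tl
          ptime_append_peek[OF ptime_var ptime_var] poly_bounded_const[of 1]]) auto
  moreover have "foldl (\<lambda>a s. take 1 s @ a) [] (iterates tl xs) = rev xs" for xs :: "'b list"
  proof -
    have "foldl (\<lambda>a s. take 1 s @ a) [] (iterates tl xs) = foldl (\<lambda>a x. x # a) [] xs"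
      by (rule foldl_iterates_tl) simp
    also have "\<dots> = rev xs"
      by (simp add: foldl_conv_fold fold_Cons_rev)
    finally show ?thesis .
  qed
  ultimately show ?thesis by simp
qed

lemma ptime_append:
  assumes f: "ptime V f" and g: "ptime V g" shows "ptime V (\<lambda>\<rho>. f \<rho> @ g \<rho>)"
proof -
  have "ptime V (\<lambda>\<rho>. foldl (\<lambda>a s. take 1 s @ a) (g \<rho>) (iterates tl (rev (f \<rho>))))"
    by (rule ptime_fold_growth[OF ptime_rev[OF f] g ptime_tl[OF ptime_id] shortens_tl
          ptime_append_peek[OF ptime_var ptime_var] poly_bounded_const[of 1]]) auto
  moreover have "foldl (\<lambda>a s. take 1 s @ a) ys (iterates tl (rev xs)) = xs @ ys" for xs ys :: "'b list"
  proof -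
    have "foldl (\<lambda>a s. take 1 s @ a) ys (iterates tl (rev xs)) = foldl (\<lambda>a x. x # a) ys (rev xs)"
      by (rule foldl_iterates_tl) simp
    then show ?thesis
      by (simp add: foldl_conv_fold fold_Cons_rev)
  qed
  ultimately show ?thesis by simp
qed

definition head_sat :: "('a \<Rightarrow> bool) \<Rightarrow> 'a option \<Rightarrow> bool" where
  "head_sat P h \<longleftrightarrow> (\<exists>x. h = Some x \<and> P x)"

lemma head_sat_simps [simp]: "head_sat P None = False" "head_sat P (Some x) = P x"
  by (auto simp: head_sat_def)

text \<open>The list is scanned from its end, and everything collected is discarded at each symbol
  that violates \<open>P\<close>. What survives is the part before the first violation.\<close>

lemma ptime_takeWhile:
  assumes "ptime V f" shows "ptime V (\<lambda>\<rho>. takeWhile P (f \<rho>))"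
proof -
  let ?F = "\<lambda>a s. if head_sat P (peek s) then take 1 s @ a else []"
  have "ptime V (\<lambda>\<rho>. foldl ?F [] (iterates tl (rev (f \<rho>))))"
    by (rule ptime_fold_growth[OF ptime_rev[OF assms] ptime_const ptime_tl[OF ptime_id] shortens_tl
          ptime_if_peek[OF ptime_var ptime_append_peek[OF ptime_var ptime_var] ptime_const]
          poly_bounded_const[of 1]]) auto
  moreover have "foldl ?F [] (iterates tl (rev xs)) = takeWhile P xs" for xs
  proof -
    have "foldl ?F [] (iterates tl (rev xs)) = foldl (\<lambda>a x. if P x then x # a else []) [] (rev xs)"
      by (rule foldl_iterates_tl) simp
    also have "\<dots> = foldr (\<lambda>x a. if P x then x # a else []) xs []"
      by (simp add: foldl_conv_foldr)
    also have "\<dots> = takeWhile P xs"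
      by (induction xs) auto
    finally show ?thesis .
  qed
  ultimately show ?thesis by simp
qed

text \<open>The suffixes act as a clock with one tick per symbol. Each tick pops the accumulator as
  long as its top satisfies \<open>P\<close>; afterwards nothing changes.\<close>

lemma ptime_dropWhile:
  assumes "ptime V f" shows "ptime V (\<lambda>\<rho>. dropWhile P (f \<rho>))"
proof -
  let ?F = "\<lambda>a s. if head_sat P (peek a) then tl a else a"
  have "ptime V (\<lambda>\<rho>. foldl ?F (f \<rho>) (iterates tl (f \<rho>)))"
    by (rule ptime_fold_growth[OF assms assms ptime_tl[OF ptime_id] shortens_tl
          ptime_if_peek[OF ptime_var ptime_tl[OF ptime_var] ptime_var]
          poly_bounded_const[of 0]]) auto
  moreover have "foldl ?F xs (iterates tl xs) = dropWhile P xs" for xs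
  proof -
    have stuck: "foldl (\<lambda>a x. if head_sat P (peek a) then tl a else a) (x # xs) ys = x # xs"
      if "\<not> P x" for x xs and ys :: "'b list"
      using that by (induction ys) auto
    have "foldl (\<lambda>a x. if head_sat P (peek a) then tl a else a) xs ys = dropWhile P xs"
      if "length ys \<ge> length xs" for ys :: "'b list"
      using that
    proof (induction ys arbitrary: xs)
      case (Cons y ys)
      then show ?case by (cases xs) (auto simp: Cons.IH stuck)
    qed simp
    then show ?thesis
      using foldl_iterates_tl[of ?F "\<lambda>a x. if head_sat P (peek a) then tl a else a" xs xs] by simp
  qed
  ultimately show ?thesis by simp
qed

lemma pdec_eq:
  fixes f g :: "'c \<Rightarrow> 'a::finite list"
  assumes f: "ptime V f" and g: "ptime V g" shows "pdec V (\<lambda>\<rho>. f \<rho> = g \<rho>)"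
proof -
  \<comment> \<open>The accumulator is a marker on top of what remains of the second list, and a
    mismatch erases both. In the end the bare marker means equality, the empty list a mismatch, and
    anything longer an unread rest.\<close>
  let ?F = "\<lambda>a s. if peek (tl a) = peek s then undefined # tl (tl a) else []"
  let ?h = "\<lambda>a x. if peek (tl a) = Some x then undefined # tl (tl a) else []"
  have F: "ptime (bind2 V) (\<lambda>z. ?F (fst (snd z)) (snd (snd z)))"
    by (intro ptime_if pdec_eq_peek ptime_Cons ptime_tl ptime_const ptime_var) simp_all
  have "ptime V (\<lambda>\<rho>. foldl ?F (undefined # g \<rho>) (iterates tl (f \<rho>)))"
    by (rule ptime_fold_growth[OF f ptime_Cons[OF g] ptime_tl[OF ptime_id] shortens_tl F
          poly_bounded_const[of 1]]) auto
  then have "pdec V (\<lambda>\<rho>. let r = foldl ?F (undefined # g \<rho>) (iterates tl (f \<rho>)) in r \<noteq> [] \<and> tl r = [])"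
    unfolding Let_def by (intro pdec_conj pdec_nonempty pdec_empty ptime_tl)
  moreover have "(let r = foldl ?F (undefined # ys) (iterates tl xs) in r \<noteq> [] \<and> tl r = []) \<longleftrightarrow> xs = ys"
    for xs ys :: "'a list"
  proof -
    have fail: "foldl ?h [] xs = []" for xs
      by (induction xs) auto
    have "foldl ?F (undefined # ys) (iterates tl xs) = foldl ?h (undefined # ys) xs"
      by (rule foldl_iterates_tl) simp
    moreover have "(foldl ?h (undefined # ys) xs \<noteq> [] \<and> tl (foldl ?h (undefined # ys) xs) = []) \<longleftrightarrow> xs = ys"
    proof (induction xs arbitrary: ys)
      case (Cons x xs)
      then show ?case by (cases ys) (auto simp: fail)
    qed auto
    ultimately show ?thesis by simp
  qed
  ultimately show ?thesis by simp
qed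

theorem PTIME_I:
  fixes X :: "'a::finite list set"
  assumes "pdec [\<lambda>w. w] (\<lambda>w. w \<in> X)"
  shows "X \<in> PTIME"
proof -
  obtain c B where c: "computes [\<lambda>w. w] [0] 1 (\<lambda>w. flag (w \<in> X) :: 'a list) c B"
    by (rule ptimeE[OF assms[unfolded pdec_def], of "[0]" 1]) auto
  obtain d where d: "B n \<le> (n + 2) ^ d" for n
    using computes_poly[OF c] unfolding poly_bounded_def by blast
  obtain T where T: "wf_tm T" "\<And>w t \<sigma>. exec c ((\<lambda>_. [])(0 := w)) t \<sigma> \<Longrightarrow>
      fst ((tm_step T ^^ (t + 3)) (tm_initial T w)) =
        (if \<sigma> 1 \<noteq> [] then tm_accept T else tm_reject T)"
    using decider_of_cmd[of c] by blast
  \<comment> \<open>\<open>[:2, 1:] ^ d\<close> evaluates to \<open>(n + 2) ^ d\<close>, the bound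
    for the program; the compiled machine adds 3 steps.\<close>
  have "decides_in_time T X (poly ([:2, 1:] ^ d + [:3:]))"
    unfolding decides_in_time_def
  proof
    fix w :: "'a list"
    let ?\<sigma> = "(\<lambda>_. [])(0 := w)"
    have "runs c ?\<sigma> (?\<sigma>(1 := flag (w \<in> X))) (B (length w))"
      by (rule computes_runs[OF c]) (auto simp: clean_def)
    then obtain t where t: "t \<le> B (length w)" "exec c ?\<sigma> t (?\<sigma>(1 := flag (w \<in> X)))"
      unfolding runs_def by blast
    have "t + 3 \<le> poly ([:2, 1:] ^ d + [:3:]) (length w)"
      using t(1) d[of "length w"] by (simp add: poly_power add.commute)
    then show "\<exists>n\<le>poly ([:2, 1:] ^ d + [:3:]) (length w).
        fst ((tm_step T ^^ n) (tm_initial T w)) = (if w \<in> X then tm_accept T else tm_reject T)"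
      using T(2)[OF t(2)] by (intro exI[of _ "t + 3"]) auto
  qed
  with T(1) show ?thesis unfolding PTIME_def by blast
qed

section \<open>Names and rows in a text\<close>

instance symbol :: finite
proof
  have "UNIV = insert Comma (insert Semicolon (range Bit))"
    by (auto intro: symbol.exhaust)
  then show "finite (UNIV :: symbol set)"
    by (metis finite.insertI finite_imageI finite_class.finite_UNIV)
qed

definition nm :: "symbol list \<Rightarrow> symbol list" where
  "nm s = takeWhile (\<lambda>x. x \<noteq> Comma) s"

definition nx :: "symbol list \<Rightarrow> symbol list" where
  "nx s = tl (dropWhile (\<lambda>x. x \<noteq> Comma) s)"

definition names :: "symbol list \<Rightarrow> symbol list list" where
  "names c = map nm (iterates nx c)"

text \<open>Rows have no delimiter of their own: a row is a group of consecutive names, and the next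
  row is reached by a multiple application of \<open>nx\<close>. In an incomplete last row the
  missing names read as empty.\<close>

definition pairs :: "symbol list \<Rightarrow> (symbol list \<times> symbol list) list" where
  "pairs c = map (\<lambda>s. (nm s, nm (nx s))) (iterates (\<lambda>s. nx (nx s)) c)"

definition triples :: "symbol list \<Rightarrow> (symbol list \<times> symbol list \<times> symbol list) list" where
  "triples c = map (\<lambda>s. (nm s, nm (nx s), nm (nx (nx s)))) (iterates (\<lambda>s. nx (nx (nx s))) c)"

definition quadruples ::
    "symbol list \<Rightarrow> (symbol list \<times> symbol list \<times> symbol list \<times> symbol list) list" where
  "quadruples c = map (\<lambda>s. (nm s, nm (nx s), nm (nx (nx s)), nm (nx (nx (nx s)))))
    (iterates (\<lambda>s. nx (nx (nx (nx s)))) c)"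

lemma shortens_nx: "shortens nx"
  unfolding shortens_def
proof (intro allI impI)
  fix s :: "symbol list" assume "s \<noteq> []"
  moreover have "length (dropWhile (\<lambda>x. x \<noteq> Comma) s) \<le> length s"
    by (rule length_dropWhile_le)
  ultimately show "length (nx s) < length s"
    unfolding nx_def by (cases s) (simp_all only: length_tl, auto)
qed

lemma length_nx_le: "length (nx s) \<le> length s"
  using shortens_nx by (cases "s = []") (auto simp: shortens_def nx_def less_imp_le)

lemma shortens_nx_comp: "shortens g \<Longrightarrow> shortens (\<lambda>s. nx (g s))"
  unfolding shortens_def using length_nx_le le_less_trans by blast

lemmas shortens_nxs = shortens_nx shortens_nx_comp

lemma length_nm_le: "length (nm s) \<le> length s"
  by (simp add: nm_def length_takeWhile_le)

lemma ptime_nm: "ptime V f \<Longrightarrow> ptime V (\<lambda>\<rho>. nm (f \<rho>))"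
  unfolding nm_def by (rule ptime_takeWhile)

lemma ptime_nx: "ptime V f \<Longrightarrow> ptime V (\<lambda>\<rho>. nx (f \<rho>))"
  unfolding nx_def by (intro ptime_tl ptime_dropWhile)

text \<open>Names and rows are functions of the suffix at whose front they stand, so quantification
  over them is quantification over iterates. The variants for rows differ in the number of names
  that one iteration skips.\<close>

lemma pdec_ex_names:
  assumes "ptime V l" "pdec (bind1 V) (\<lambda>z. Q (fst z) (nm (snd z)))"
  shows "pdec V (\<lambda>\<rho>. \<exists>x\<in>set (names (l \<rho>)). Q \<rho> x)"
  using pdec_ex[of nx, OF ptime_nx[OF ptime_id] shortens_nx assms] by (simp add: names_def)

lemma pdec_ex_pairs:
  assumes "ptime V l" "pdec (bind1 V) (\<lambda>z. Q (fst z) (nm (snd z)) (nm (nx (snd z))))"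
  shows "pdec V (\<lambda>\<rho>. \<exists>(x, y)\<in>set (pairs (l \<rho>)). Q \<rho> x y)"
  using pdec_ex[of "\<lambda>s. nx (nx s)", OF _ _ assms] 
  by (simp add: pairs_def ptime_nx ptime_id shortens_nxs)

lemma pdec_ex_triples:
  assumes "ptime V l"
    and "pdec (bind1 V) (\<lambda>z. Q (fst z) (nm (snd z)) (nm (nx (snd z))) (nm (nx (nx (snd z)))))"
  shows "pdec V (\<lambda>\<rho>. \<exists>(x, y, z)\<in>set (triples (l \<rho>)). Q \<rho> x y z)"
  using pdec_ex[of "\<lambda>s. nx (nx (nx s))", OF _ _ assms]
  by (simp add: triples_def ptime_nx ptime_id shortens_nxs)

lemma pdec_ex_quadruples:
  assumes "ptime V l"
    and "pdec (bind1 V) (\<lambda>z. Q (fst z) (nm (snd z)) (nm (nx (snd z))) (nm (nx (nx (snd z))))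
      (nm (nx (nx (nx (snd z))))))"
  shows "pdec V (\<lambda>\<rho>. \<exists>(x, y, u, v)\<in>set (quadruples (l \<rho>)). Q \<rho> x y u v)"
  using pdec_ex[of "\<lambda>s. nx (nx (nx (nx s)))", OF _ _ assms]
  by (simp add: quadruples_def ptime_nx ptime_id shortens_nxs)

lemma pdec_all_names:
  assumes "ptime V l" "pdec (bind1 V) (\<lambda>z. Q (fst z) (nm (snd z)))"
  shows "pdec V (\<lambda>\<rho>. \<forall>x\<in>set (names (l \<rho>)). Q \<rho> x)"
  by (rule pdec_cong[OF pdec_not[OF pdec_ex_names[OF assms(1) pdec_not[OF assms(2)]]]]) auto

lemma pdec_all_triples:
  assumes "ptime V l"
    and "pdec (bind1 V) (\<lambda>z. Q (fst z) (nm (snd z)) (nm (nx (snd z))) (nm (nx (nx (snd z)))))"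
  shows "pdec V (\<lambda>\<rho>. \<forall>(x, y, z)\<in>set (triples (l \<rho>)). Q \<rho> x y z)"
  by (rule pdec_cong[OF pdec_not[OF pdec_ex_triples[OF assms(1) pdec_not[OF assms(2)]]]]) auto

lemma pdec_all_quadruples:
  assumes "ptime V l"
    and "pdec (bind1 V) (\<lambda>z. Q (fst z) (nm (snd z)) (nm (nx (snd z))) (nm (nx (nx (snd z))))
      (nm (nx (nx (nx (snd z))))))"
  shows "pdec V (\<lambda>\<rho>. \<forall>(x, y, u, v)\<in>set (quadruples (l \<rho>)). Q \<rho> x y u v)"
  by (rule pdec_cong[OF pdec_not[OF pdec_ex_quadruples[OF assms(1) pdec_not[OF assms(2)]]]]) auto

text \<open>Membership is a quantified equality. It is first shown for projections, which as
  variables remain accessible under the binder; composition then inserts the actual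
  functions.\<close>

lemma pdec_in_names:
  assumes "ptime V f" "ptime V l" shows "pdec V (\<lambda>\<rho>. f \<rho> \<in> set (names (l \<rho>)))"
proof -
  have "pdec [fst, snd] (\<lambda>z :: symbol list \<times> symbol list. \<exists>x\<in>set (names (snd z)). x = fst z)"
    by (intro pdec_ex_names pdec_eq ptime_nm ptime_var) simp_all
  then show ?thesis
    using pdec_comp2[of "\<lambda>x l. x \<in> set (names l)" V f l] assms by simp
qed

lemma pdec_in_pairs:
  assumes "ptime V f" "ptime V g" "ptime V l"
  shows "pdec V (\<lambda>\<rho>. (f \<rho>, g \<rho>) \<in> set (pairs (l \<rho>)))"
proof -
  have "pdec [fst, \<lambda>z. fst (snd z), \<lambda>z. snd (snd z)]
    (\<lambda>z :: symbol list \<times> symbol list \<times> symbol list.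
      \<exists>(x, y)\<in>set (pairs (snd (snd z))). x = fst z \<and> y = fst (snd z))"
    by (intro pdec_ex_pairs pdec_conj pdec_eq ptime_nm ptime_nx ptime_var) simp_all
  then have "pdec [fst, \<lambda>z. fst (snd z), \<lambda>z. snd (snd z)]
    (\<lambda>z :: symbol list \<times> symbol list \<times> symbol list. (fst z, fst (snd z)) \<in> set (pairs (snd (snd z))))"
    by (rule pdec_cong) auto
  then show ?thesis
    using pdec_comp3[of "\<lambda>x y l. (x, y) \<in> set (pairs l)" V f g l] assms by simp
qed

section \<open>Reading back written texts\<close>

definition comma_text :: "symbol list list \<Rightarrow> symbol list" where
  "comma_text xs = concat (map (\<lambda>x. x @ [Comma]) xs)"

definition pair_text :: "(symbol list \<times> symbol list) list \<Rightarrow> symbol list" where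
  "pair_text L = comma_text (concat (map (\<lambda>(x, y). [x, y]) L))"

lemma comma_text_simps [simp]:
  "comma_text [] = []" "comma_text (x # xs) = x @ Comma # comma_text xs"
  by (simp_all add: comma_text_def)

lemma comma_text_eq_Nil [simp]: "comma_text xs = [] \<longleftrightarrow> xs = []"
  by (cases xs) auto

lemma nm_text: "Comma \<notin> set x \<Longrightarrow> nm (x @ Comma # r) = x"
  by (induction x) (auto simp: nm_def)

lemma nx_text: "Comma \<notin> set x \<Longrightarrow> nx (x @ Comma # r) = r"
  by (induction x) (auto simp: nx_def)

lemma comma_notin_nm: "Comma \<notin> set (nm s)"
  by (auto simp: nm_def dest: set_takeWhileD)

lemma names_comma_text: "\<forall>x\<in>set xs. Comma \<notin> set x \<Longrightarrow> names (comma_text xs) = xs"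
  by (induction xs) (simp_all add: names_def iterates_step[OF shortens_nx] nm_text nx_text)

lemma pairs_pair_text:
  "\<forall>(x, y)\<in>set L. Comma \<notin> set x \<and> Comma \<notin> set y \<Longrightarrow> pairs (pair_text L) = L"
  by (induction L) (auto simp: pairs_def pair_text_def iterates_step shortens_nxs nm_text nx_text)

lemma triples_comma_text:
  "\<forall>(x, y, z)\<in>set L. Comma \<notin> set x \<and> Comma \<notin> set y \<and> Comma \<notin> set z \<Longrightarrow>
    triples (comma_text (concat (map (\<lambda>(x, y, z). [x, y, z]) L))) = L"
  by (induction L) (auto simp: triples_def iterates_step shortens_nxs nm_text nx_text)

lemma quadruples_comma_text:
  "\<forall>(x, y, u, v)\<in>set L. Comma \<notin> set x \<and> Comma \<notin> set y \<and> Comma \<notin> set u \<and> Comma \<notin> set v \<Longrightarrow>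
    quadruples (comma_text (concat (map (\<lambda>(x, y, u, v). [x, y, u, v]) L))) = L"
  by (induction L) (auto simp: quadruples_def iterates_step shortens_nxs nm_text nx_text)

lemma length_names_le: "length (names c) \<le> length c"
  by (simp add: names_def length_iterates_le)

lemma in_names_length_le: "x \<in> set (names c) \<Longrightarrow> length x \<le> length c"
  by (auto simp: names_def intro!: le_trans[OF length_nm_le in_iterates_length_le])

lemma ptime_fold_names:
  assumes l: "ptime V l" and i: "ptime V i"
    and F: "ptime (bind2 V) (\<lambda>z. F (fst z) (fst (snd z)) (nm (snd (snd z))))"
    and C: "poly_bounded C"
      "\<And>\<rho> N a x. \<forall>v\<in>set V. length (v \<rho>) \<le> N \<Longrightarrow> length x \<le> length (l \<rho>) \<Longrightarrow>
        length (F \<rho> a x) \<le> length a + C N"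
  shows "ptime V (\<lambda>\<rho>. foldl (F \<rho>) (i \<rho>) (names (l \<rho>)))"
proof -
  have "ptime V (\<lambda>\<rho>. foldl (\<lambda>a s. F \<rho> a (nm s)) (i \<rho>) (iterates nx (l \<rho>)))"
    by (rule ptime_fold_growth[OF l i ptime_nx[OF ptime_id] shortens_nx F C(1)])
      (auto intro!: C(2) le_trans[OF length_nm_le])
  then show ?thesis
    by (simp add: names_def foldl_map)
qed

section \<open>The components of an input\<close>

definition skip_component :: "symbol list \<Rightarrow> symbol list" where
  "skip_component s = tl (dropWhile (\<lambda>x. x \<noteq> Semicolon) s)"

definition component :: "nat \<Rightarrow> symbol list \<Rightarrow> symbol list" where
  "component k w = takeWhile (\<lambda>x. x \<noteq> Semicolon) ((skip_component ^^ k) w)"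

text \<open>Only the last name can be unclosed, so the last symbol decides. Reversal makes this a
  test of one top symbol.\<close>

definition terminated :: "symbol list \<Rightarrow> bool" where
  "terminated c \<longleftrightarrow> peek (rev c) \<in> {None, Some Comma}"

text \<open>These conditions single out the values of \<open>encode_lists\<close>. The first makes
  the semicolon of the seventh component the end of the input. The last two exclude rows that break
  off: after all but one of the names of a row some text must follow, and even an empty name takes
  up a comma. Termination is phrased as a finite disjunction over the component numbers.\<close>

definition well_formed :: "symbol list \<Rightarrow> bool" where
  "well_formed w \<longleftrightarrow>
    dropWhile (\<lambda>x. x \<noteq> Semicolon) ((skip_component ^^ 6) w) = [Semicolon] \<and>
    \<not> (\<exists>k\<in>{..<7}. \<not> terminated (component k w)) \<and>
    component 3 w \<noteq> [] \<and> nx (component 3 w) = [] \<and>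
    (\<forall>s\<in>set (iterates (\<lambda>s. nx (nx (nx (nx s)))) (component 4 w)). nx (nx (nx s)) \<noteq> []) \<and>
    (\<forall>s\<in>set (iterates (\<lambda>s. nx (nx (nx s))) (component 6 w)). nx (nx s) \<noteq> [])"

lemma ptime_iterate:
  assumes "ptime [\<lambda>x. x] g" "ptime V f"
  shows "ptime V (\<lambda>\<rho>. (g ^^ k) (f \<rho>))"
  using assms(2) by (induction k) (simp_all add: ptime_comp1[OF assms(1)])

lemma ptime_skip_component: "ptime V f \<Longrightarrow> ptime V (\<lambda>\<rho>. skip_component (f \<rho>))"
  unfolding skip_component_def by (intro ptime_tl ptime_dropWhile)

lemma ptime_component: "ptime V f \<Longrightarrow> ptime V (\<lambda>\<rho>. component k (f \<rho>))"
  unfolding component_def by (intro ptime_takeWhile ptime_iterate ptime_skip_component ptime_id)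

lemma pdec_terminated: "ptime V f \<Longrightarrow> pdec V (\<lambda>\<rho>. terminated (f \<rho>))"
  unfolding terminated_def by (rule pdec_peek[OF ptime_rev])

lemma pdec_well_formed: "pdec [\<lambda>w. w] well_formed"
  unfolding well_formed_def
  by (intro pdec_conj pdec_not pdec_ex_finite pdec_terminated pdec_eq pdec_nonempty pdec_empty
      ptime_component ptime_const pdec_all ptime_nx ptime_dropWhile ptime_iterate ptime_skip_component ptime_var
      shortens_nxs) simp_all

section \<open>The refinement algorithm\<close>

text \<open>The tables are those of a synchronous machine. All quantifiers range over listed
  entries, so that each of them becomes a fold over a text. Polymorphism lets the same formula be
  evaluated on words of the input and interpreted on bit strings.\<close>

definition consistent ::
  "'n set \<Rightarrow> 'n set \<Rightarrow> 'n set \<Rightarrow> 'n \<Rightarrow> ('n \<times> 'n \<times> 'n \<times> 'n) set \<Rightarrow> 'n set \<Rightarrow> ('n \<times> 'n \<times> 'n) set \<Rightarrow> bool"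
  where "consistent S H L i T X B \<longleftrightarrow>
    i \<in> S \<and>
    (\<forall>(s, a, b, t)\<in>T. s \<in> S \<and> a \<in> H \<and> b \<in> L \<and> t \<in> S) \<and>
    (\<forall>(s, x, y)\<in>B. s \<in> S \<and> x \<in> X \<and> y \<in> X) \<and>
    (\<forall>s\<in>S. \<exists>(s', x, y)\<in>B. s' = s) \<and>
    (\<forall>(s, x, y)\<in>B. \<forall>(s', x', y')\<in>B. s = s' \<longrightarrow> x = x' \<and> y = y') \<and>
    (\<forall>s\<in>S. \<forall>a\<in>H. \<forall>b\<in>L. \<exists>(s', a', b', t)\<in>T. s' = s \<and> a' = a \<and> b' = b)"

text \<open>\<open>v\<close> is the observation of agent L. A row of \<open>T\<close> supplies both
  \<open>a1\<close> and \<open>a3\<close> of the unwinding condition, so that \<open>c\<close>, in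
  the role of \<open>a2\<close>, is the one action quantified over \<open>H\<close>.\<close>

definition related ::
  "'n set \<Rightarrow> ('n \<times> 'n \<times> 'n \<times> 'n) set \<Rightarrow> ('n \<times> 'n \<times> 'n) set \<Rightarrow> ('n \<times> 'n) set \<Rightarrow> 'n \<Rightarrow> 'n \<Rightarrow> bool"
  where "related H T B R x y \<longleftrightarrow>
    (y, x) \<in> R \<and>
    (\<forall>(s, u, v)\<in>B. \<forall>(s', u', v')\<in>B. s = x \<and> s' = y \<longrightarrow> v = v') \<and>
    (\<forall>(s, a, b, t)\<in>T. s = x \<longrightarrow>
      (\<forall>c\<in>H. \<exists>(s', a', b', t')\<in>T. s' = y \<and> a' = c \<and> b' = b \<and> (t, t') \<in> R))"

text \<open>The reversal mirrors a left fold that writes every surviving row in front of the text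
  written so far.\<close>

definition refine ::
  "'n set \<Rightarrow> ('n \<times> 'n \<times> 'n \<times> 'n) set \<Rightarrow> ('n \<times> 'n \<times> 'n) set \<Rightarrow> ('n \<times> 'n) list \<Rightarrow> ('n \<times> 'n) list"
  where "refine H T B L = rev (filter (\<lambda>(x, y). related H T B (set L) x y) L)"

definition all_pairs_text :: "symbol list \<Rightarrow> symbol list" where
  "all_pairs_text c =
    foldl (\<lambda>a x. foldl (\<lambda>a y. x @ Comma # y @ Comma # a) a (names c)) [] (names c)"

definition refine_text :: "symbol list \<Rightarrow> symbol list \<Rightarrow> symbol list" where
  "refine_text w r = foldl (\<lambda>a (x, y).
      if related (set (names (component 1 w))) (set (quadruples (component 4 w)))
        (set (triples (component 6 w))) (set (pairs r)) x y
      then x @ Comma # y @ Comma # a else a) [] (pairs r)"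

text \<open>The text of all pairs is both the initial value and the clock: one round for each of its
  rows yields quadratically many rounds without arithmetic.\<close>

definition final_text :: "symbol list \<Rightarrow> symbol list" where
  "final_text w = foldl (\<lambda>r _. refine_text w r) (all_pairs_text (component 0 w))
    (iterates (\<lambda>s. nx (nx s)) (all_pairs_text (component 0 w)))"

definition accepted :: "symbol list \<Rightarrow> bool" where
  "accepted w \<longleftrightarrow> well_formed w \<and>
    consistent (set (names (component 0 w))) (set (names (component 1 w)))
      (set (names (component 2 w))) (nm (component 3 w)) (set (quadruples (component 4 w)))
      (set (names (component 5 w))) (set (triples (component 6 w))) \<and>
    (nm (component 3 w), nm (component 3 w)) \<in> set (pairs (final_text w))"

lemma ptime_all_pairs_text:
  assumes "ptime V f" shows "ptime V (\<lambda>\<rho>. all_pairs_text (f \<rho>))"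
proof -
  have inner: "ptime [fst, \<lambda>z. fst (snd z), \<lambda>z. snd (snd z)]
    (\<lambda>z. foldl (\<lambda>a y. snd (snd z) @ Comma # y @ Comma # a) (fst (snd z)) (names (fst z)))"
  \<comment> \<open>A row consists of two names of length at most \<open>N\<close> and two
    commas.\<close>
  proof (rule ptime_fold_names[where C="\<lambda>N. 2 * N + 2"])
    show "ptime (bind2 [fst, \<lambda>z. fst (snd z), \<lambda>z. snd (snd z)])
        (\<lambda>z. snd (snd (fst z)) @ Comma # nm (snd (snd z)) @ Comma # fst (snd z))"
      by (intro ptime_append ptime_Cons ptime_nm ptime_var) simp_all
  next
    fix z :: "symbol list \<times> symbol list \<times> symbol list" and N :: nat and a y :: "symbol list"
    assume "\<forall>v\<in>set [fst, \<lambda>z. fst (snd z), \<lambda>z. snd (snd z)]. length (v z) \<le> N"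
      and "length y \<le> length (fst z)"
    then show "length (snd (snd z) @ Comma # y @ Comma # a) \<le> length a + (2 * N + 2)"
      by simp
  next
    show "poly_bounded (\<lambda>N. 2 * N + 2)"
      by (intro poly_intros)
  qed (rule ptime_var, simp)+
  have "ptime [\<lambda>x. x] all_pairs_text"
    unfolding all_pairs_text_def
  \<comment> \<open>The inner fold adds one such row for each of at most \<open>N\<close>
    names.\<close>
  proof (rule ptime_fold_names[where C="\<lambda>N. N * (2 * N + 2)"])
    show "ptime (bind2 [\<lambda>c. c]) (\<lambda>z. foldl (\<lambda>a y. nm (snd (snd z)) @ Comma # y @ Comma # a)
        (fst (snd z)) (names (fst z)))"
      by (intro ptime_nm ptime_var
          ptime_comp3[of "\<lambda>c a x. foldl (\<lambda>a y. x @ Comma # y @ Comma # a) a (names c)", OF inner])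
        simp_all
  next
    fix c a x :: "symbol list" and N
    assume "\<forall>v\<in>set [\<lambda>c. c]. length (v c) \<le> N" and x: "length x \<le> length c"
    then have c: "length c \<le> N" by simp
    have "length (foldl (\<lambda>a y. x @ Comma # y @ Comma # a) a (names c)) \<le>
        length a + length (names c) * (2 * N + 2)"
    proof (rule length_foldl_le)
      fix a y :: "symbol list" assume "y \<in> set (names c)"
      then have "length y \<le> length c" by (rule in_names_length_le)
      then show "length (x @ Comma # y @ Comma # a) \<le> length a + (2 * N + 2)"
        using x c by simp
    qed
    also have "\<dots> \<le> length a + N * (2 * N + 2)"
      using length_names_le[of c] c by (intro add_left_mono mult_le_mono1) simp
    finally show "length (foldl (\<lambda>a y. x @ Comma # y @ Comma # a) a (names c)) \<le>
        length a + N * (2 * N + 2)" .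
  next
    show "poly_bounded (\<lambda>N. N * (2 * N + 2))"
      by (intro poly_intros)
  qed (rule ptime_const ptime_id)+
  then show ?thesis
    using assms by (rule ptime_comp1)
qed

lemma ptime_refine_text:
  assumes "ptime V f" "ptime V g" shows "ptime V (\<lambda>\<rho>. refine_text (f \<rho>) (g \<rho>))"
proof -
  let ?P = "\<lambda>w r x y. related (set (names (component 1 w))) (set (quadruples (component 4 w)))
        (set (triples (component 6 w))) (set (pairs r)) x y"
  have "ptime [fst, snd] (\<lambda>z. foldl (\<lambda>a s. if ?P (fst z) (snd z) (nm s) (nm (nx s))
      then nm s @ Comma # nm (nx s) @ Comma # a else a) [] (iterates (\<lambda>s. nx (nx s)) (snd z)))"
  proof (rule ptime_fold_growth[where C="\<lambda>N. 2 * N + 2"])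
    show "ptime (bind2 [fst, snd]) (\<lambda>z. if ?P (fst (fst z)) (snd (fst z)) (nm (snd (snd z)))
        (nm (nx (snd (snd z)))) then nm (snd (snd z)) @ Comma # nm (nx (snd (snd z))) @ Comma #
          fst (snd z) else fst (snd z))"
      unfolding related_def
      by (intro ptime_if ptime_append ptime_Cons ptime_nm ptime_nx ptime_component pdec_conj pdec_imp
          pdec_in_pairs pdec_all_triples pdec_all_quadruples pdec_all_names pdec_ex_quadruples pdec_eq
          ptime_var) simp_all
  next
    fix \<rho> :: "symbol list \<times> symbol list" and N :: nat and a s :: "symbol list"
    assume "\<forall>v\<in>set [fst, snd]. length (v \<rho>) \<le> N" "length s \<le> length (snd \<rho>)"
    then have s: "length s \<le> N" by simp
    have "length (nm s) \<le> N" "length (nm (nx s)) \<le> N"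
      using s length_nm_le[of s] length_nm_le[of "nx s"] length_nx_le[of s] by simp_all
    then show "length (if ?P (fst \<rho>) (snd \<rho>) (nm s) (nm (nx s))
        then nm s @ Comma # nm (nx s) @ Comma # a else a) \<le> length a + (2 * N + 2)"
      by simp
  next
    show "poly_bounded (\<lambda>N. 2 * N + 2)"
      by (intro poly_intros)
  next
    show "ptime [fst, snd] (snd :: symbol list \<times> symbol list \<Rightarrow> _)"
      by (rule ptime_var) simp
  qed (intro ptime_nx ptime_id ptime_const shortens_nxs)+
  then have "ptime [fst, snd] (\<lambda>z. refine_text (fst z) (snd z))"
    unfolding refine_text_def pairs_def foldl_map by simp
  then show ?thesis
    using assms by (rule ptime_comp2)
qed

section \<open>Rounds on texts as rounds on lists of pairs\<close>

lemma foldl_const: "foldl (\<lambda>a _. f a) a xs = (f ^^ length xs) a"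
  by (induction xs arbitrary: a) (simp_all add: funpow_swap1)

lemma pair_text_simps [simp]:
  "pair_text [] = []" "pair_text ((x, y) # L) = x @ Comma # y @ Comma # pair_text L"
  by (simp_all add: pair_text_def)

definition comma_free :: "(symbol list \<times> symbol list) list \<Rightarrow> bool" where
  "comma_free L \<longleftrightarrow> (\<forall>(x, y)\<in>set L. Comma \<notin> set x \<and> Comma \<notin> set y)"

text \<open>Texts grow at the front, so the induction starts from an arbitrary text
  \<open>pair_text K\<close> already written. Names without commas guarantee that the rows read back
  are the rows written.\<close>

lemma refine_text_pair_text:
  assumes "comma_free L"
  shows "refine_text w (pair_text L) = pair_text (refine (set (names (component 1 w)))
    (set (quadruples (component 4 w))) (set (triples (component 6 w))) L)"
proof -
  have *: "foldl (\<lambda>a (x, y). if P x y then x @ Comma # y @ Comma # a else a) (pair_text K) L =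
      pair_text (rev (filter (\<lambda>(x, y). P x y) L) @ K)" for P L K
    by (induction L arbitrary: K) (auto simp flip: pair_text_simps(2))
  show ?thesis
    using *[of _ "[]" L] pairs_pair_text[of L] assms by (simp add: refine_text_def refine_def comma_free_def)
qed

lemma comma_free_refine: "comma_free L \<Longrightarrow> comma_free (refine H T B L)"
  by (auto simp: comma_free_def refine_def)

lemma comma_free_refine_iterate: "comma_free L \<Longrightarrow> comma_free ((refine H T B ^^ n) L)"
  by (induction n) (simp_all add: comma_free_refine)

lemma refine_text_iterate:
  assumes "comma_free L"
  shows "(refine_text w ^^ n) (pair_text L) = pair_text ((refine (set (names (component 1 w)))
    (set (quadruples (component 4 w))) (set (triples (component 6 w))) ^^ n) L)"
  by (induction n) (simp_all add: refine_text_pair_text comma_free_refine_iterate assms)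

lemma all_pairs_text_eq: "all_pairs_text c = pair_text (rev (List.product (names c) (names c)))"
proof -
  have 1: "foldl (\<lambda>a y. x @ Comma # y @ Comma # a) (pair_text K) ys =
      pair_text (rev (map (Pair x) ys) @ K)" for x ys K
    by (induction ys arbitrary: K) (auto simp flip: pair_text_simps(2))
  have "foldl (\<lambda>a x. foldl (\<lambda>a y. x @ Comma # y @ Comma # a) a ys) (pair_text K) xs =
      pair_text (rev (List.product xs ys) @ K)" for xs ys K
    by (induction xs arbitrary: K) (simp_all add: 1)
  from this[of "names c" "[]" "names c"] show ?thesis
    by (simp add: all_pairs_text_def)
qed

lemma comma_free_product_names: "comma_free (rev (List.product (names c) (names c)))"
  by (auto simp: comma_free_def names_def comma_notin_nm)

lemma length_pair_text_refine: "length (pair_text (refine H T B L)) \<le> length (pair_text L)"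
proof -
  have app: "length (pair_text (K @ L)) = length (pair_text K) + length (pair_text L)" for K L
    by (induction K) auto
  have rev: "length (pair_text (rev K)) = length (pair_text K)" for K
    by (induction K) (auto simp: app)
  have "length (pair_text (filter P K)) \<le> length (pair_text K)" for P K
    by (induction K) auto
  then show ?thesis
    by (simp add: refine_def rev)
qed

lemma length_pair_text_refine_iterate:
  "length (pair_text ((refine H T B ^^ n) L)) \<le> length (pair_text L)"
  by (induction n) (auto intro: le_trans[OF length_pair_text_refine])

lemma length_iterates_pairs: "length (iterates (\<lambda>s. nx (nx s)) c) = length (pairs c)"
  by (simp add: pairs_def)

lemma pairs_final_text:
  "pairs (final_text w) =
    (refine (set (names (component 1 w))) (set (quadruples (component 4 w)))
      (set (triples (component 6 w))) ^^ (length (names (component 0 w)))\<^sup>2)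
      (rev (List.product (names (component 0 w)) (names (component 0 w))))"
proof -
  let ?L = "rev (List.product (names (component 0 w)) (names (component 0 w)))"
  have "length (pairs (pair_text ?L)) = (length (names (component 0 w)))\<^sup>2"
    using pairs_pair_text[of ?L] comma_free_product_names[of "component 0 w"]
    by (simp add: comma_free_def power2_eq_square)
  then show ?thesis
    by (simp add: final_text_def foldl_const all_pairs_text_eq length_iterates_pairs refine_text_iterate
        comma_free_product_names pairs_pair_text
        comma_free_refine_iterate[OF comma_free_product_names, unfolded comma_free_def])
qed

text \<open>Rounds only delete rows, so no text on the way is longer than the initial one. This is
  known for texts written from pairs, hence the fold rule that bounds just the accumulators
  reached.\<close>

lemma ptime_final_text: "ptime [\<lambda>w. w] final_text"
proof -
  have all: "ptime [\<lambda>w. w] (\<lambda>w. all_pairs_text (component 0 w))"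
    by (intro ptime_all_pairs_text ptime_component ptime_id)
  obtain B where B: "poly_bounded B" "\<forall>w N. (\<forall>v\<in>set [\<lambda>w. w]. length (v w) \<le> N) \<longrightarrow>
      length (all_pairs_text (component 0 w)) \<le> B N"
    using ptime_length[OF all] by blast
  show ?thesis
    unfolding final_text_def
  proof (rule ptime_fold[OF all all _ _ _ B(1)])
    show "ptime (bind2 [\<lambda>w. w]) (\<lambda>z. refine_text (fst z) (fst (snd z)))"
      by (intro ptime_refine_text ptime_var) simp_all
  next
    fix w :: "symbol list" and N j
    assume "\<forall>v\<in>set [\<lambda>w. w]. length (v w) \<le> N"
    then have "length (all_pairs_text (component 0 w)) \<le> B N"
      using B(2) by blast
    then show "length (foldl (\<lambda>r _. refine_text w r) (all_pairs_text (component 0 w))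
        (take j (iterates (\<lambda>s. nx (nx s)) (all_pairs_text (component 0 w))))) \<le> B N"
      by (simp add: foldl_const all_pairs_text_eq refine_text_iterate comma_free_product_names
          le_trans[OF length_pair_text_refine_iterate])
  qed (intro ptime_nx ptime_id shortens_nxs)+
qed

lemma pdec_accepted: "pdec [\<lambda>w. w] accepted"
  unfolding accepted_def consistent_def
  by (intro pdec_conj pdec_well_formed pdec_in_names pdec_all_quadruples pdec_all_triples
      pdec_all_names pdec_ex_triples pdec_ex_quadruples pdec_imp pdec_eq pdec_in_pairs
      ptime_final_text ptime_nm ptime_nx ptime_component ptime_var) simp_all

section \<open>Correctness\<close>

lemma set_refine: "set (refine H T B L) = {(x, y). (x, y) \<in> set L \<and> related H T B (set L) x y}"
  by (auto simp: refine_def)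

lemma related_mono: "related H T B R x y \<Longrightarrow> R \<subseteq> R' \<Longrightarrow> related H T B R' x y"
  unfolding related_def by fast

text \<open>A round that deletes nothing leaves the set unchanged for good, and any other round
  shortens the list. So \<open>length L\<close> rounds reach stability.\<close>

lemma refine_iterate_stable:
  assumes "length L \<le> n" "(x, y) \<in> set ((refine H T B ^^ n) L)"
  shows "related H T B (set ((refine H T B ^^ n) L)) x y"
  using assms
proof (induction n arbitrary: L)
  case (Suc n)
  show ?case
  proof (cases "\<forall>(x, y)\<in>set L. related H T B (set L) x y")
    case True
    \<comment> \<open>Sets are compared because a round without deletions still reverses the
      list.\<close>
    have "set ((refine H T B ^^ k) L) = set L" for k
      by (induction k) (use True in \<open>auto simp: set_refine\<close>)
    with True Suc.prems show ?thesis
      by (auto simp del: funpow.simps)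
  next
    case False
    then have "length (refine H T B L) < length L"
      by (auto simp: refine_def intro!: length_filter_less)
    with Suc show ?thesis
      by (simp add: funpow_Suc_right del: funpow.simps)
  qed
qed simp

lemma refine_iterate_greatest:
  assumes "\<And>x y. (x, y) \<in> R \<Longrightarrow> related H T B R x y" "R \<subseteq> set L"
  shows "R \<subseteq> set ((refine H T B ^^ n) L)"
proof (induction n)
  case (Suc n)
  then show ?case
    using assms(1) by (auto simp: set_refine intro: related_mono)
qed (use assms(2) in simp)

section \<open>Refinement and unwinding relations of a machine\<close>

definition flatten_row :: "'s \<times> ('h \<times> 'l) \<times> 't \<Rightarrow> 's \<times> 'h \<times> 'l \<times> 't" where
  "flatten_row = (\<lambda>(s, (a, b), t). (s, a, b, t))"

definition obs_rows :: "('s, 'h, 'l, 'o) machine \<Rightarrow> ('s \<times> 'o \<times> 'o) set" where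
  "obs_rows M = (\<lambda>s. (s, obs M s AgH, obs M s AgL)) ` states M"

abbreviation machine_related ::
    "('n, 'n, 'n, 'n) machine \<Rightarrow> ('n \<times> 'n) set \<Rightarrow> 'n \<Rightarrow> 'n \<Rightarrow> bool" where
  "machine_related M \<equiv> related (acts_H M) (flatten_row ` trans_rel M) (obs_rows M)"

text \<open>Every state has a row in the observation table, so for states the table clause really
  compares observations; for other names it would hold vacuously.\<close>

lemma machine_related_iff:
  assumes "x \<in> states M" "y \<in> states M"
  shows "machine_related M R x y \<longleftrightarrow> (y, x) \<in> R \<and> obs M x AgL = obs M y AgL \<and>
    (\<forall>a b t. (x, (a, b), t) \<in> trans_rel M \<longrightarrow>
      (\<forall>c\<in>acts_H M. \<exists>t'. (y, (c, b), t') \<in> trans_rel M \<and> (t, t') \<in> R))"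
proof -
  have B: "(\<forall>(s, u, v)\<in>obs_rows M. \<forall>(s', u', v')\<in>obs_rows M. s = x \<and> s' = y \<longrightarrow> v = v') \<longleftrightarrow>
      obs M x AgL = obs M y AgL"
    using assms by (auto simp: obs_rows_def)
  have mem: "(s, a, b, t) \<in> flatten_row ` trans_rel M \<longleftrightarrow> (s, (a, b), t) \<in> trans_rel M" for s a b t
    by (force simp: flatten_row_def image_iff)
  have T: "(\<forall>(s, a, b, t)\<in>flatten_row ` trans_rel M. s = x \<longrightarrow>
      (\<forall>c\<in>acts_H M. \<exists>(s', a', b', t')\<in>flatten_row ` trans_rel M.
        s' = y \<and> a' = c \<and> b' = b \<and> (t, t') \<in> R)) \<longleftrightarrow>
    (\<forall>a b t. (x, (a, b), t) \<in> trans_rel M \<longrightarrow>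
      (\<forall>c\<in>acts_H M. \<exists>t'. (y, (c, b), t') \<in> trans_rel M \<and> (t, t') \<in> R))"
    unfolding Ball_def Bex_def split_paired_All split_paired_Ex prod.case mem by blast
  show ?thesis
    unfolding related_def B T ..
qed

text \<open>Symmetry is the clause of \<open>related\<close> about the swapped pair. In the forward
  direction the unwinding condition asks for actions in \<open>acts_H\<close> and
  \<open>acts_L\<close>, which the typing of the transition relation supplies.\<close>

lemma synchronous_unwinding_iff:
  assumes "synchronous_machine M"
  shows "synchronous_unwinding M R \<longleftrightarrow> R \<subseteq> states M \<times> states M \<and> (initial M, initial M) \<in> R \<and>
    (\<forall>x y. (x, y) \<in> R \<longrightarrow> machine_related M R x y)"
proof
  assume R: "synchronous_unwinding M R"
  have "machine_related M R x y" if xy: "(x, y) \<in> R" for x y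
  proof -
    have "\<exists>t'. (y, (c, b), t') \<in> trans_rel M \<and> (t, t') \<in> R"
      if "(x, (a, b), t) \<in> trans_rel M" "c \<in> acts_H M" for a b t c
    proof -
      have "a \<in> acts_H M" "b \<in> acts_L M"
        using assms that(1) unfolding synchronous_machine_def by blast+
      then show ?thesis
        using R xy that unfolding synchronous_unwinding_def by blast
    qed
    moreover have "x \<in> states M" "y \<in> states M" "(y, x) \<in> R" "obs M x AgL = obs M y AgL"
      using R xy unfolding synchronous_unwinding_def sym_def by blast+
    ultimately show ?thesis
      by (simp add: machine_related_iff)
  qed
  then show "R \<subseteq> states M \<times> states M \<and> (initial M, initial M) \<in> R \<and>
      (\<forall>x y. (x, y) \<in> R \<longrightarrow> machine_related M R x y)"
    using R unfolding synchronous_unwinding_def by blast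
next
  assume R: "R \<subseteq> states M \<times> states M \<and> (initial M, initial M) \<in> R \<and>
      (\<forall>x y. (x, y) \<in> R \<longrightarrow> machine_related M R x y)"
  have rel: "(y, x) \<in> R \<and> obs M x AgL = obs M y AgL \<and>
      (\<forall>a b t. (x, (a, b), t) \<in> trans_rel M \<longrightarrow>
        (\<forall>c\<in>acts_H M. \<exists>t'. (y, (c, b), t') \<in> trans_rel M \<and> (t, t') \<in> R))"
    if "(x, y) \<in> R" for x y
  proof -
    have "x \<in> states M" "y \<in> states M" "machine_related M R x y"
      using R that by blast+
    then show ?thesis
      using machine_related_iff[of x M y R] by blast
  qed
  show "synchronous_unwinding M R"
    unfolding synchronous_unwinding_def
  proof (intro conjI)
    show "sym R"
      using rel by (auto intro: symI)
  qed (use R rel in \<open>simp_all, blast?\<close>)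
qed

lemma RES_iff:
  assumes "synchronous_machine M" "set L = states M \<times> states M" "length L \<le> n"
  shows "M \<in> RES \<longleftrightarrow> (initial M, initial M) \<in>
    set ((refine (acts_H M) (flatten_row ` trans_rel M) (obs_rows M) ^^ n) L)"
    (is "_ \<longleftrightarrow> _ \<in> set ((?f ^^ n) L)")
proof
  assume "M \<in> RES"
  then obtain R where R: "synchronous_unwinding M R"
    by (auto simp: RES_def)
  then have "R \<subseteq> set ((?f ^^ n) L)"
    using assms(2) unfolding synchronous_unwinding_iff[OF assms(1)]
    by (intro refine_iterate_greatest) auto
  with R show "(initial M, initial M) \<in> set ((?f ^^ n) L)"
    by (auto simp: synchronous_unwinding_def)
next
  assume "(initial M, initial M) \<in> set ((?f ^^ n) L)"
  moreover have "set ((?f ^^ k) L) \<subseteq> set L" for k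
    by (induction k) (auto simp: set_refine)
  ultimately have "synchronous_unwinding M (set ((?f ^^ n) L))"
    using refine_iterate_stable[OF assms(3)] assms(2)
    unfolding synchronous_unwinding_iff[OF assms(1)] by blast
  then show "M \<in> RES"
    by (auto simp: RES_def)
qed

section \<open>Invariance under injective renaming\<close>

definition map4 :: "('a \<Rightarrow> 'b) \<Rightarrow> 'a \<times> 'a \<times> 'a \<times> 'a \<Rightarrow> 'b \<times> 'b \<times> 'b \<times> 'b" where
  "map4 f = map_prod f (map_prod f (map_prod f f))"

definition map3 :: "('a \<Rightarrow> 'b) \<Rightarrow> 'a \<times> 'a \<times> 'a \<Rightarrow> 'b \<times> 'b \<times> 'b" where
  "map3 f = map_prod f (map_prod f f)"

text \<open>Names enter the formula through equality and membership alone, and an injection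
  preserves and reflects both.\<close>

lemma consistent_map:
  assumes "inj f"
  shows "consistent (f ` S) (f ` H) (f ` L) (f i) (map4 f ` T) (f ` X) (map3 f ` B) \<longleftrightarrow>
    consistent S H L i T X B"
  by (simp add: consistent_def map4_def map3_def case_prod_unfold inj_image_mem_iff[OF assms]
      inj_eq[OF assms])

lemma related_map:
  assumes "inj f"
  shows "related (f ` H) (map4 f ` T) (map3 f ` B) (map_prod f f ` R) (f x) (f y) \<longleftrightarrow>
    related H T B R x y"
proof -
  have "(f u, f v) \<in> map_prod f f ` R \<longleftrightarrow> (u, v) \<in> R" for u v
    using inj_image_mem_iff[OF prod.inj_map[OF assms assms], of "(u, v)"] by simp
  then show ?thesis
    by (simp add: related_def map4_def map3_def case_prod_unfold inj_eq[OF assms])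
qed

lemma refine_map:
  assumes "inj f"
  shows "refine (f ` H) (map4 f ` T) (map3 f ` B) (map (map_prod f f) L) =
    map (map_prod f f) (refine H T B L)"
  by (simp add: refine_def rev_map filter_map o_def case_prod_unfold related_map[OF assms])

lemma refine_iterate_map:
  assumes "inj f"
  shows "(refine (f ` H) (map4 f ` T) (map3 f ` B) ^^ n) (map (map_prod f f) L) =
    map (map_prod f f) ((refine H T B ^^ n) L)"
  by (induction n) (simp_all add: refine_map[OF assms])

section \<open>Texts of bit-string names\<close>

abbreviation bits :: "name \<Rightarrow> symbol list" where
  "bits \<equiv> map Bit"

lemma inj_bits: "inj bits"
  by (simp add: inj_def)

lemma nm_bits [simp]: "nm (bits x @ Comma # r) = bits x"
  by (rule nm_text) auto

lemma nx_bits [simp]: "nx (bits x @ Comma # r) = r"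
  by (rule nx_text) auto

definition name_text :: "name list \<Rightarrow> symbol list" where
  "name_text xs = comma_text (map bits xs)"

lemma encode_component_eq: "encode_component xs = name_text xs @ [Semicolon]"
  by (simp add: encode_component_def name_text_def comma_text_def encode_name_def[abs_def] o_def)

lemma name_text_simps [simp]:
  "name_text [] = []" "name_text (x # xs) = bits x @ Comma # name_text xs"
  "name_text xs = [] \<longleftrightarrow> xs = []"
  by (simp_all add: name_text_def)

lemma semicolon_notin_name_text: "Semicolon \<notin> set (name_text xs)"
  by (induction xs) auto

lemma terminated_name_text: "terminated (name_text xs)"
proof (cases xs rule: rev_cases)
  case (snoc ys y)
  then show ?thesis
    by (simp add: name_text_def comma_text_def terminated_def)
qed (simp add: terminated_def)

text \<open>The first comma cuts off a name whose symbols are neither commas nor semicolons, hence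
  bits. The rest is empty or still ends in a comma, so induction on the length applies.\<close>

lemma name_textI:
  assumes "terminated c" "Semicolon \<notin> set c"
  shows "\<exists>xs. c = name_text xs"
  using assms
proof (induction "length c" arbitrary: c rule: less_induct)
  case less
  show ?case
  proof (cases "c = []")
    case False
    then obtain c' where "c = c' @ [Comma]"
      using less.prems(1) by (cases c rule: rev_cases) (auto simp: terminated_def)
    then have "Comma \<in> set c" by simp
    then obtain p r where p: "c = p @ Comma # r" "Comma \<notin> set p"
      by (meson split_list_first)
    have "Semicolon \<notin> set p"
      using p(1) less.prems(2) by simp
    then have "\<exists>b. x = Bit b" if "x \<in> set p" for x
      using that p(2) by (cases x) metis+
    then obtain b where "p = map Bit b"
      by (metis ex_map_conv)
    moreover have "terminated r"
      using less.prems(1) p(1) by (cases r rule: rev_cases) (auto simp: terminated_def)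
    then obtain xs where "r = name_text xs"
      using less.hyps[of r] less.prems(2) p(1) by auto
    ultimately have "c = name_text (b # xs)"
      using p(1) by simp
    then show ?thesis ..
  qed (auto intro: exI[of _ "[]"])
qed

lemma nx_name_text: "nx (name_text xs) = name_text (tl xs)"
  by (cases xs) (simp_all add: nx_def[of "[]"])

lemma nm_name_text: "nm (name_text (x # xs)) = bits x"
  by simp

lemma names_name_text: "names (name_text xs) = map bits xs"
  unfolding name_text_def by (rule names_comma_text) auto

lemma triples_name_text:
  "triples (name_text (concat (map (\<lambda>(x, y, z). [x, y, z]) L))) = map (map3 bits) L"
proof -
  have "name_text (concat (map (\<lambda>(x, y, z). [x, y, z]) L)) =
      comma_text (concat (map (\<lambda>(x, y, z). [x, y, z]) (map (map3 bits) L)))"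
    by (simp add: name_text_def map_concat o_def case_prod_unfold map3_def)
  moreover have "\<forall>(x, y, z)\<in>set (map (map3 bits) L). Comma \<notin> set x \<and> Comma \<notin> set y \<and> Comma \<notin> set z"
    by (auto simp: map3_def)
  ultimately show ?thesis
    by (simp only: triples_comma_text)
qed

lemma quadruples_name_text:
  "quadruples (name_text (concat (map (\<lambda>(s, (a, b), t). [s, a, b, t]) L))) =
    map (map4 bits) (map flatten_row L)"
proof -
  have "name_text (concat (map (\<lambda>(s, (a, b), t). [s, a, b, t]) L)) =
      comma_text (concat (map (\<lambda>(x, y, u, v). [x, y, u, v]) (map (map4 bits) (map flatten_row L))))"
    by (simp add: name_text_def map_concat o_def case_prod_unfold map4_def flatten_row_def)
  moreover have "\<forall>(x, y, u, v)\<in>set (map (map4 bits) (map flatten_row L)).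
      Comma \<notin> set x \<and> Comma \<notin> set y \<and> Comma \<notin> set u \<and> Comma \<notin> set v"
    by (auto simp: map4_def flatten_row_def)
  ultimately show ?thesis
    by (simp only: quadruples_comma_text)
qed

text \<open>Every name, even the empty one, contributes a comma, so a text of names is empty exactly
  if no name is left. Text after the second name of a row thus shows that the third is
  present.\<close>

lemma triples_complete_iff:
  "(\<forall>s\<in>set (iterates (\<lambda>s. nx (nx (nx s))) (name_text xs)). nx (nx s) \<noteq> []) \<longleftrightarrow>
    (\<exists>L :: (name \<times> name \<times> name) list. xs = concat (map (\<lambda>(x, y, z). [x, y, z]) L))"
proof
  assume "\<forall>s\<in>set (iterates (\<lambda>s. nx (nx (nx s))) (name_text xs)). nx (nx s) \<noteq> []"
  then show "\<exists>L :: (name \<times> name \<times> name) list. xs = concat (map (\<lambda>(x, y, z). [x, y, z]) L)"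
  proof (induction "length xs" arbitrary: xs rule: less_induct)
    case less
    show ?case
    proof (cases "xs = []")
      case False
      have iterates: "iterates (\<lambda>s. nx (nx (nx s))) (name_text xs) =
          name_text xs # iterates (\<lambda>s. nx (nx (nx s))) (name_text (tl (tl (tl xs))))"
        by (subst iterates_step) (simp_all add: shortens_nxs nx_name_text False)
      from less.prems False have "tl (tl xs) \<noteq> []"
        by (simp add: iterates nx_name_text)
      then obtain x y z ys where xs: "xs = x # y # z # ys"
        by (metis list.sel(3) neq_Nil_conv tl_Nil)
      have "\<forall>s\<in>set (iterates (\<lambda>s. nx (nx (nx s))) (name_text ys)). nx (nx s) \<noteq> []"
        using less.prems[unfolded iterates] by (simp add: xs)
      then obtain L where "ys = concat (map (\<lambda>(x, y, z). [x, y, z]) (L :: (name \<times> name \<times> name) list))"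
        using less.hyps[of ys] xs by auto
      then have "xs = concat (map (\<lambda>(x, y, z). [x, y, z]) ((x, y, z) # L))"
        by (simp add: xs)
      then show ?thesis ..
    qed (auto intro: exI[of _ "[]"])
  qed
next
  assume "\<exists>L :: (name \<times> name \<times> name) list. xs = concat (map (\<lambda>(x, y, z). [x, y, z]) L)"
  then obtain L :: "(name \<times> name \<times> name) list"
    where L: "xs = concat (map (\<lambda>(x, y, z). [x, y, z]) L)" by blast
  show "\<forall>s\<in>set (iterates (\<lambda>s. nx (nx (nx s))) (name_text xs)). nx (nx s) \<noteq> []"
    unfolding L
    by (induction L) (auto simp: iterates_step shortens_nxs)
qed

lemma quadruples_complete_iff:
  "(\<forall>s\<in>set (iterates (\<lambda>s. nx (nx (nx (nx s)))) (name_text xs)). nx (nx (nx s)) \<noteq> []) \<longleftrightarrow>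
    (\<exists>L :: (name \<times> (name \<times> name) \<times> name) list. xs = concat (map (\<lambda>(s, (a, b), t). [s, a, b, t]) L))"
proof
  assume "\<forall>s\<in>set (iterates (\<lambda>s. nx (nx (nx (nx s)))) (name_text xs)). nx (nx (nx s)) \<noteq> []"
  then show "\<exists>L :: (name \<times> (name \<times> name) \<times> name) list.
      xs = concat (map (\<lambda>(s, (a, b), t). [s, a, b, t]) L)"
  proof (induction "length xs" arbitrary: xs rule: less_induct)
    case less
    show ?case
    proof (cases "xs = []")
      case False
      have iterates: "iterates (\<lambda>s. nx (nx (nx (nx s)))) (name_text xs) =
          name_text xs # iterates (\<lambda>s. nx (nx (nx (nx s)))) (name_text (tl (tl (tl (tl xs)))))"
        by (subst iterates_step) (simp_all add: shortens_nxs nx_name_text False)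
      from less.prems False have "tl (tl (tl xs)) \<noteq> []"
        by (simp add: iterates nx_name_text)
      then obtain s a b t ys where xs: "xs = s # a # b # t # ys"
        by (metis list.sel(3) neq_Nil_conv tl_Nil)
      have "\<forall>s\<in>set (iterates (\<lambda>s. nx (nx (nx (nx s)))) (name_text ys)). nx (nx (nx s)) \<noteq> []"
        using less.prems[unfolded iterates] by (simp add: xs)
      then obtain L where "ys = concat (map (\<lambda>(s, (a, b), t). [s, a, b, t])
          (L :: (name \<times> (name \<times> name) \<times> name) list))"
        using less.hyps[of ys] xs by auto
      then have "xs = concat (map (\<lambda>(s, (a, b), t). [s, a, b, t]) ((s, (a, b), t) # L))"
        by (simp add: xs)
      then show ?thesis ..
    qed (auto intro: exI[of _ "[]"])
  qed
next
  assume "\<exists>L :: (name \<times> (name \<times> name) \<times> name) list.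
      xs = concat (map (\<lambda>(s, (a, b), t). [s, a, b, t]) L)"
  then obtain L :: "(name \<times> (name \<times> name) \<times> name) list"
    where L: "xs = concat (map (\<lambda>(s, (a, b), t). [s, a, b, t]) L)" by blast
  show "\<forall>s\<in>set (iterates (\<lambda>s. nx (nx (nx (nx s)))) (name_text xs)). nx (nx (nx s)) \<noteq> []"
    unfolding L
    by (induction L) (auto simp: iterates_step shortens_nxs)
qed

section \<open>Splitting an input into components\<close>

lemma component_0: "Semicolon \<notin> set c \<Longrightarrow> component 0 (c @ Semicolon # r) = c"
  by (induction c) (auto simp: component_def)

lemma skip_component_text: "Semicolon \<notin> set c \<Longrightarrow> skip_component (c @ Semicolon # r) = r"
  by (induction c) (auto simp: skip_component_def)

lemma component_Suc: "component (Suc k) w = component k (skip_component w)"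
  by (simp add: component_def funpow_swap1)

lemma semicolon_notin_component: "Semicolon \<notin> set (component k w)"
  by (auto simp: component_def dest: set_takeWhileD)

text \<open>Without a semicolon, skipping would consume everything; a nonempty rest therefore proves
  that the separator is there.\<close>

lemma split_component:
  assumes "skip_component w \<noteq> []"
  shows "w = component 0 w @ Semicolon # skip_component w"
proof -
  let ?d = "dropWhile (\<lambda>x. x \<noteq> Semicolon) w"
  have "?d \<noteq> []"
  proof
    assume "?d = []"
    with assms show False by (simp add: skip_component_def del: dropWhile_eq_Nil_conv)
  qed
  then have "?d = Semicolon # skip_component w"
    using hd_dropWhile[of "\<lambda>x. x \<noteq> Semicolon" w] unfolding skip_component_def
    by (cases ?d) auto
  then show ?thesis
    using takeWhile_dropWhile_id[of "\<lambda>x. x \<noteq> Semicolon" w] by (simp add: component_def)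
qed

text \<open>\<open>encodes\<close> with its existentially quantified lists as arguments, so that
  parsing can be treated before any machine is at hand.\<close>

definition encode_lists ::
  "name list \<Rightarrow> name list \<Rightarrow> name list \<Rightarrow> name \<Rightarrow> (name \<times> (name \<times> name) \<times> name) list \<Rightarrow> name list \<Rightarrow>
    (name \<times> name \<times> name) list \<Rightarrow> symbol list"
  where "encode_lists ss hs ls i ts os bs =
    encode_component ss @ encode_component hs @ encode_component ls @ encode_component [i] @
    encode_component (concat (map (\<lambda>(s, (a, b), s'). [s, a, b, s']) ts)) @
    encode_component os @
    encode_component (concat (map (\<lambda>(s, x, y). [s, x, y]) bs))"

lemma component_encode_lists:
  assumes "w = encode_lists ss hs ls i ts os bs"
  shows "component 0 w = name_text ss" "component 1 w = name_text hs"
    "component 2 w = name_text ls" "component 3 w = name_text [i]"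
    "component 4 w = name_text (concat (map (\<lambda>(s, (a, b), s'). [s, a, b, s']) ts))"
    "component 5 w = name_text os"
    "component 6 w = name_text (concat (map (\<lambda>(s, x, y). [s, x, y]) bs))"
    "(skip_component ^^ 6) w = component 6 w @ [Semicolon]"
  by (simp_all only: assms encode_lists_def encode_component_eq append.assoc append.simps
      eval_nat_numeral One_nat_def component_Suc BitM.simps component_0 skip_component_text semicolon_notin_name_text
      not_False_eq_True funpow.simps o_apply id_apply funpow_swap1)

lemma well_formed_encode_lists: "well_formed (encode_lists ss hs ls i ts os bs)"
proof -
  define w where "w = encode_lists ss hs ls i ts os bs"
  note c = component_encode_lists[OF w_def]
  have drop: "dropWhile (\<lambda>x. x \<noteq> Semicolon) (c @ [Semicolon]) = [Semicolon]"
    if "Semicolon \<notin> set c" for c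
    using that by (induction c) auto
  have "terminated (component k w)" if "k < 7" for k
    using that c(1-7) terminated_name_text
    by (auto simp: less_Suc_eq eval_nat_numeral simp del: name_text_simps)
  then show ?thesis
    using c(8) drop[OF semicolon_notin_name_text] triples_complete_iff quadruples_complete_iff
    unfolding well_formed_def w_def[symmetric]
    by (auto simp: c(4,5,7))
qed

lemma well_formedE:
  assumes "well_formed w"
  obtains ss hs ls i ts os bs where "w = encode_lists ss hs ls i ts os bs"
proof -
  let ?s = "\<lambda>k. (skip_component ^^ k) w"
  have last: "dropWhile (\<lambda>x. x \<noteq> Semicolon) (?s 6) = [Semicolon]"
    and term_comp: "\<And>k. k < 7 \<Longrightarrow> terminated (component k w)"
    and c3: "component 3 w \<noteq> []" "nx (component 3 w) = []"
    and c4: "\<forall>s\<in>set (iterates (\<lambda>s. nx (nx (nx (nx s)))) (component 4 w)). nx (nx (nx s)) \<noteq> []"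
    and c6: "\<forall>s\<in>set (iterates (\<lambda>s. nx (nx (nx s))) (component 6 w)). nx (nx s) \<noteq> []"
    using assms unfolding well_formed_def by auto
  have skip_Nil: "skip_component [] = []"
    by (simp add: skip_component_def)
  have "?s 6 \<noteq> []"
    using last by auto
  \<comment> \<open>Skipping keeps the empty text empty, so an empty rest at an earlier stage would
    make the rest after six components empty too.\<close>
  have ne: "?s (Suc k) \<noteq> []" if "k < 6" for k
  proof
    assume "?s (Suc k) = []"
    then have "(skip_component ^^ n) (?s (Suc k)) = []" for n
      by (induction n) (simp_all add: skip_Nil)
    from this[of "5 - k"] have "?s (5 - k + Suc k) = []"
      by (simp only: funpow_add o_apply)
    then show False
      using \<open>?s 6 \<noteq> []\<close> that by simp
  qed
  have step: "?s k = component k w @ Semicolon # ?s (Suc k)" if "k < 6" for k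
    using split_component[of "?s k"] ne[OF that] by (simp add: component_def)
  have "?s 6 = component 6 w @ [Semicolon]"
    using takeWhile_dropWhile_id[of "\<lambda>x. x \<noteq> Semicolon" "?s 6"] last by (simp add: component_def)
  then have w: "w = component 0 w @ Semicolon # component 1 w @ Semicolon # component 2 w @ Semicolon #
      component 3 w @ Semicolon # component 4 w @ Semicolon # component 5 w @ Semicolon #
      component 6 w @ [Semicolon]"
    using step[of 0] step[of 1] step[of 2] step[of 3] step[of 4] step[of 5]
    by (simp add: eval_nat_numeral del: funpow.simps(2))
  have "\<exists>xs. component k w = name_text xs" if "k < 7" for k
    by (rule name_textI[OF term_comp[OF that] semicolon_notin_component])
  then obtain X where X: "\<And>k. k < 7 \<Longrightarrow> component k w = name_text (X k)"
    by metis
  obtain i where i: "X 3 = [i]"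
    using c3 X[of 3] by (cases "X 3") auto
  obtain ts where ts: "X 4 = concat (map (\<lambda>(s, (a, b), t). [s, a, b, t]) ts)"
    using c4 X[of 4] quadruples_complete_iff[of "X 4"] by auto
  obtain bs where bs: "X 6 = concat (map (\<lambda>(x, y, z). [x, y, z]) bs)"
    using c6 X[of 6] triples_complete_iff[of "X 6"] by auto
  have "w = encode_lists (X 0) (X 1) (X 2) i ts (X 5) bs"
    unfolding encode_lists_def encode_component_eq i[symmetric] ts[symmetric] bs[symmetric]
    by (subst w) (simp add: X)
  then show thesis by (rule that)
qed

text \<open>The names in the text are images of bit strings under the injection \<open>bits\<close>,
  so the renaming lemmas carry the verdict over to the original names. Repetitions in
  \<open>ss\<close> lengthen the list of pairs and the number of rounds alike.\<close>

lemma accepted_encode_lists: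
  "accepted (encode_lists ss hs ls i ts os bs) \<longleftrightarrow>
    consistent (set ss) (set hs) (set ls) i (flatten_row ` set ts) (set os) (set bs) \<and>
    (i, i) \<in> set ((refine (set hs) (flatten_row ` set ts) (set bs) ^^ (length ss)\<^sup>2)
      (rev (List.product ss ss)))"
proof -
  define w where "w = encode_lists ss hs ls i ts os bs"
  note c = component_encode_lists[OF w_def]
  have prod: "rev (List.product (map bits ss) (map bits ss)) =
      map (map_prod bits bits) (rev (List.product ss ss))"
  proof -
    have "List.product (map bits xs) (map bits ys) = map (map_prod bits bits) (List.product xs ys)" for xs ys
      by (induction xs) simp_all
    then show ?thesis by (simp add: rev_map)
  qed
  have mem: "(bits i, bits i) \<in> map_prod bits bits ` A \<longleftrightarrow> (i, i) \<in> A" for A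
    using inj_image_mem_iff[OF prod.inj_map[OF inj_bits inj_bits], of "(i, i)" A] by simp
  have i: "nm (component 3 w) = bits i"
    by (simp only: c nm_name_text)
  have "accepted w \<longleftrightarrow>
    consistent (bits ` set ss) (bits ` set hs) (bits ` set ls) (bits i)
      (map4 bits ` flatten_row ` set ts) (bits ` set os) (map3 bits ` set bs) \<and>
    (bits i, bits i) \<in> set ((refine (bits ` set hs) (map4 bits ` flatten_row ` set ts)
      (map3 bits ` set bs) ^^ (length ss)\<^sup>2) (rev (List.product (map bits ss) (map bits ss))))"
    using well_formed_encode_lists[of ss hs ls i ts os bs, folded w_def]
    unfolding accepted_def pairs_final_text i unfolding c names_name_text triples_name_text quadruples_name_text
      set_map length_map by blast
  then show ?thesis
    unfolding prod refine_iterate_map[OF inj_bits] consistent_map[OF inj_bits] set_map mem w_def .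
qed

section \<open>Inputs and machines\<close>

lemma consistent_machine:
  assumes "synchronous_machine M"
  shows "consistent (states M) (acts_H M) (acts_L M) (initial M) (flatten_row ` trans_rel M)
    (observations M) (obs_rows M)"
proof -
  have init: "initial M \<in> states M"
    and sub: "trans_rel M \<subseteq> states M \<times> (acts_H M \<times> acts_L M) \<times> states M"
    and ob: "\<forall>s\<in>states M. \<forall>u. obs M s u \<in> observations M"
    and enabled: "\<forall>s\<in>states M. \<forall>a\<in>acts_H M \<times> acts_L M. \<exists>s'\<in>states M. (s, a, s') \<in> trans_rel M"
    using assms unfolding synchronous_machine_def by blast+
  have "\<exists>(s', a', b', t)\<in>flatten_row ` trans_rel M. s' = s \<and> a' = a \<and> b' = b"
    if s: "s \<in> states M" and ab: "a \<in> acts_H M" "b \<in> acts_L M" for s a b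
  proof -
    obtain t where "(s, (a, b), t) \<in> trans_rel M"
      using bspec[OF bspec[OF enabled s], of "(a, b)"] ab by blast
    then show ?thesis
      by (intro bexI[of _ "(s, a, b, t)"]) (auto simp: flatten_row_def image_iff intro: rev_bexI)
  qed
  moreover have "\<forall>(s, a, b, t)\<in>flatten_row ` trans_rel M.
      s \<in> states M \<and> a \<in> acts_H M \<and> b \<in> acts_L M \<and> t \<in> states M"
    using sub by (auto simp: flatten_row_def)
  moreover have "\<forall>(s, x, y)\<in>obs_rows M. s \<in> states M \<and> x \<in> observations M \<and> y \<in> observations M"
    using ob by (auto simp: obs_rows_def)
  moreover have "\<forall>s\<in>states M. \<exists>(s', x, y)\<in>obs_rows M. s' = s"
    by (simp add: obs_rows_def)
  moreover have "\<forall>(s, x, y)\<in>obs_rows M. \<forall>(s', x', y')\<in>obs_rows M. s = s' \<longrightarrow> x = x' \<and> y = y'"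
    by (simp add: obs_rows_def)
  ultimately show ?thesis
    unfolding consistent_def using init by blast
qed

lemma machine_of_consistent:
  assumes "consistent (set ss) (set hs) (set ls) i (flatten_row ` set ts) (set os) (set bs)"
  obtains M :: named_machine where "synchronous_machine M" "states M = set ss" "acts_H M = set hs"
    "acts_L M = set ls" "initial M = i" "trans_rel M = set ts" "observations M = set os"
    "obs_rows M = set bs"
proof -
  \<comment> \<open>Observations are read off the table: on states the choice succeeds because a row
    exists, and it is the only row by uniqueness. Outside the states its value is arbitrary, and
    \<open>obs_rows\<close> ranges over states.\<close>
  define ob where "ob s = (SOME p. (s, p) \<in> set bs)" for s
  define M where "M = \<lparr>states = set ss, acts_H = set hs, acts_L = set ls, initial = i,
    trans_rel = set ts, observations = set os,
    obs = (\<lambda>s u. case u of AgH \<Rightarrow> fst (ob s) | AgL \<Rightarrow> snd (ob s))\<rparr>"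
  have i: "i \<in> set ss"
    and T: "\<forall>(s, a, b, t)\<in>flatten_row ` set ts. s \<in> set ss \<and> a \<in> set hs \<and> b \<in> set ls \<and> t \<in> set ss"
    and B: "\<forall>(s, x, y)\<in>set bs. s \<in> set ss \<and> x \<in> set os \<and> y \<in> set os"
    and total: "\<forall>s\<in>set ss. \<exists>(s', x, y)\<in>set bs. s' = s"
    and unique: "\<forall>(s, x, y)\<in>set bs. \<forall>(s', x', y')\<in>set bs. s = s' \<longrightarrow> x = x' \<and> y = y'"
    and enabled: "\<forall>s\<in>set ss. \<forall>a\<in>set hs. \<forall>b\<in>set ls.
      \<exists>(s', a', b', t)\<in>flatten_row ` set ts. s' = s \<and> a' = a \<and> b' = b"
    using assms unfolding consistent_def by - (elim conjE, assumption)+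
  have ob: "(s, ob s) \<in> set bs" if s: "s \<in> set ss" for s
  proof -
    obtain x y where "(s, x, y) \<in> set bs"
      using bspec[OF total s] by auto
    then show ?thesis
      unfolding ob_def by (rule someI[of "\<lambda>p. (s, p) \<in> set bs"])
  qed
  have uniq: "p = q" if "(s, p) \<in> set bs" "(s, q) \<in> set bs" for s p q
    using bspec[OF bspec[OF unique that(1), unfolded case_prod_unfold] that(2)]
    by (cases p; cases q) simp
  have dom: "s \<in> set ss" if "(s, p) \<in> set bs" for s p
    using bspec[OF B that] by (simp add: case_prod_unfold)
  have obs_set: "fst (ob s) \<in> set os" "snd (ob s) \<in> set os" if "s \<in> set ss" for s
    using bspec[OF B ob[OF that]] by (simp_all add: case_prod_unfold)
  have "obs_rows M = (\<lambda>s. (s, ob s)) ` set ss"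
    by (simp add: obs_rows_def M_def)
  also have "\<dots> = set bs"
  proof
    show "(\<lambda>s. (s, ob s)) ` set ss \<subseteq> set bs"
      using ob by blast
    show "set bs \<subseteq> (\<lambda>s. (s, ob s)) ` set ss"
    proof
      fix r assume r: "r \<in> set bs"
      obtain s p where sp: "r = (s, p)" by (cases r)
      then have s: "s \<in> set ss" using r dom by blast
      then have "p = ob s" using uniq[OF _ ob[OF s]] r sp by blast
      with s sp show "r \<in> (\<lambda>s. (s, ob s)) ` set ss" by blast
    qed
  qed
  finally have rows: "obs_rows M = set bs" .
  have sub: "set ts \<subseteq> set ss \<times> (set hs \<times> set ls) \<times> set ss"
  proof
    fix r assume r: "r \<in> set ts"
    obtain s a b t where "r = (s, (a, b), t)" by (cases r) auto
    then show "r \<in> set ss \<times> (set hs \<times> set ls) \<times> set ss"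
      using bspec[OF T imageI[OF r]] by (simp add: flatten_row_def)
  qed
  have "\<exists>t\<in>set ss. (s, (a, b), t) \<in> set ts" if s: "s \<in> set ss" and ab: "a \<in> set hs" "b \<in> set ls" for s a b
  proof -
    obtain t where "(s, (a, b), t) \<in> set ts"
      using bspec[OF bspec[OF bspec[OF enabled s] ab(1)] ab(2)] by (auto simp: flatten_row_def)
    with sub show ?thesis by blast
  qed
  then have "\<forall>s\<in>set ss. \<forall>a\<in>set hs \<times> set ls. \<exists>t\<in>set ss. (s, a, t) \<in> set ts"
    by blast
  moreover have "\<forall>s\<in>set ss. \<forall>u. obs M s u \<in> set os"
  proof (intro ballI allI)
    fix s u assume "s \<in> set ss"
    then show "obs M s u \<in> set os"
      using obs_set[of s] by (cases u) (simp_all add: M_def)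
  qed
  ultimately have "synchronous_machine M"
    using sub i by (simp add: synchronous_machine_def M_def)
  with rows show thesis
    by (intro that) (simp_all add: M_def)
qed

lemma encodes_iff: "encodes w M \<longleftrightarrow> (\<exists>ss hs ls ts os bs.
    set ss = states M \<and> set hs = acts_H M \<and> set ls = acts_L M \<and> set ts = trans_rel M \<and>
    set os = observations M \<and> set bs = obs_rows M \<and>
    w = encode_lists ss hs ls (initial M) ts os bs)"
  by (simp add: encodes_def encode_lists_def obs_rows_def)

lemma RES_iff_refine:
  assumes "synchronous_machine M" "set ss = states M"
  shows "M \<in> RES \<longleftrightarrow> (initial M, initial M) \<in> set ((refine (acts_H M) (flatten_row ` trans_rel M)
    (obs_rows M) ^^ (length ss)\<^sup>2) (rev (List.product ss ss)))"
  by (rule RES_iff[OF assms(1)]) (simp_all add: assms(2) power2_eq_square)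

text \<open>An accepted input is parsed into lists, and consistency makes these the components of a
  machine to which the refinement criterion applies. Conversely, the lists that witness
  \<open>encodes\<close> for some machine in \<open>RES\<close> pass all tests.\<close>

lemma accepted_iff: "accepted w \<longleftrightarrow> w \<in> RES_problem"
proof
  assume acc: "accepted w"
  then obtain ss hs ls i ts os bs where w: "w = encode_lists ss hs ls i ts os bs"
    using well_formedE unfolding accepted_def by metis
  note acc' = acc[unfolded w accepted_encode_lists]
  obtain M :: named_machine where M: "synchronous_machine M" "states M = set ss" "acts_H M = set hs"
    "acts_L M = set ls" "initial M = i" "trans_rel M = set ts" "observations M = set os"
    "obs_rows M = set bs"
    using machine_of_consistent acc' by metis
  have "M \<in> RES"
    using acc' RES_iff_refine[of M ss] M by simp
  moreover have "encodes w M"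
    unfolding encodes_iff w
    by (intro exI[of _ ss] exI[of _ hs] exI[of _ ls] exI[of _ ts] exI[of _ os] exI[of _ bs])
      (simp add: M)
  moreover have "finite_state M"
    by (simp add: finite_state_def M)
  ultimately show "w \<in> RES_problem"
    using M(1) unfolding RES_problem_def by blast
next
  assume "w \<in> RES_problem"
  then obtain M where M: "synchronous_machine M" "encodes w M" "M \<in> RES"
    unfolding RES_problem_def by blast
  then obtain ss hs ls ts os bs where lists: "set ss = states M" "set hs = acts_H M"
      "set ls = acts_L M" "set ts = trans_rel M" "set os = observations M" "set bs = obs_rows M"
    and w: "w = encode_lists ss hs ls (initial M) ts os bs"
    unfolding encodes_iff by blast
  show "accepted w"
    unfolding w accepted_encode_lists lists
    using consistent_machine[OF M(1)] RES_iff_refine[OF M(1) lists(1)] M(3) by blast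
qed

theorem theorem6: "RES_problem \<in> PTIME"
  by (rule PTIME_I[OF pdec_cong[OF pdec_accepted accepted_iff]])

end
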